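(* Let $\mathsf Q$ be a tame quasivariety of finite type. Then the following are equivalent: (1) $\mathsf Q$ is primitive; (2) for all finitely generated $\mathbf A\in\mathsf Q$, the class $[\mathsf Q:\mathbf A]$ is equational relative to $\mathsf Q$; (3) every finitely generated $\mathsf Q$-irreducible $\mathbf A\in\mathsf Q$ is weakly $\mathsf Q$-projective; (4) every finitely generated $\mathsf Q$-irreducible $\mathbf A\in\mathsf Q$ is weakly $\mathsf Q_{fg}$-projective, where $\mathsf Q_{fg}$ is the class of finitely generated algebras in $\mathsf Q$.
   Context: $\mathbf I,\mathbf H,\mathbf S,\mathbf P,\mathbf P_u$ denote the operators of isomorphic copies, homomorphic images, subalgebras, direct products and ultraproducts; $\mathbf V=\mathbf{HSP}$. A quasivariety is a class of similar algebras with $\mathsf Q=\mathbf{ISPP}_u(\mathsf Q)$; it is of finite type if its algebras have finitely many fundamental operations. For $\mathbf A\in\mathsf Q$, a $\mathsf Q$-congruence of $\mathbf A$ is a congruence $\theta$ with $\mathbf A/\theta\in\mathsf Q$; these form an algebraic lattice $\mathrm{Con}_{\mathsf Q}(\mathbf A)$. A nontrivial $\mathbf A\in\mathsf Q$ is $\mathsf Q$-irreducible if it is subdirectly irreducible relative to $\mathsf Q$, i.e. there are $a\neq b$ in $A$ with $(a,b)\in\theta$ for every $\theta\in\mathrm{Con}_{\mathsf Q}(\mathbf A)$ different from the identity congruence. An algebra in $\mathsf Q$ is $\mathsf Q$-finitely presented if it is isomorphic to $\mathbf F_{\mathsf Q}(X)/\theta_{\mathsf Q}(\Sigma)$ for some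 finite set $X$ and finite set $\Sigma$ of equations in variables from $X$, where $\mathbf F_{\mathsf Q}(X)$ is the free algebra of $\mathsf Q$ on $X$ and $\theta_{\mathsf Q}(\Sigma)$ is the least $\mathsf Q$-congruence containing all pairs $(p,q)$ with $p\approx q$ in $\Sigma$. $\mathsf Q$ is tame if every finitely generated algebra in $\mathsf Q$ is $\mathsf Q$-finitely presented. A class $\mathsf K\subseteq\mathsf Q$ is equational relative to $\mathsf Q$ if $\mathsf K=\mathbf V(\mathsf K)\cap\mathsf Q$. $\mathsf Q$ is primitive if every subquasivariety of $\mathsf Q$ is equational relative to $\mathsf Q$. For $\mathbf A\in\mathsf Q$, $[\mathsf Q:\mathbf A]=\{\mathbf B\in\mathsf Q:\mathbf A\notin\mathbf{IS}(\mathbf B)\}$. For a class $\mathsf K$ of algebras of the type of $\mathbf A$, $\mathbf A$ is weakly $\mathsf K$-projective if for all $\mathbf B\in\mathsf K$, $\mathbf A\in\mathbf H(\mathbf B)$ implies $\mathbf A\in\mathbf{IS}(\mathbf B)$.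
   Formalization: Condition (2) is stated only for finitely generated Q-irreducible A (for trivial A, or a 3-element set among all sets, it fails although Q is primitive); classes consist of algebras whose universes lie in one fixed infinite set, which loses nothing for finite type. *)

theory Defs
  imports "HOL-Library.FuncSet"
begin

section \<open>Algebras of a type\<close>

text \<open>A similarity type (signature) is a partial map: \<open>sg f = Some n\<close> says that \<open>f\<close> is a
  fundamental operation symbol of arity \<open>n\<close>. The signature may be empty, and it is finite iff
  \<open>dom sg\<close> is. The values of \<open>fop A f xs\<close> are irrelevant unless \<open>sg f = Some (length xs)\<close> and
  \<open>set xs \<subseteq> universe A\<close>; no notion below depends on them up to isomorphism.\<close>

type_synonym 'f signature = "'f \<rightharpoonup> nat"

record ('f, 'a) algebra =
  universe :: "'a set"
  fop :: "'f \<Rightarrow> 'a list \<Rightarrow> 'a"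

definition closed_under :: "'f signature \<Rightarrow> ('f, 'a) algebra \<Rightarrow> 'a set \<Rightarrow> bool" where
  "closed_under sg A C \<longleftrightarrow>
     (\<forall>f xs. sg f = Some (length xs) \<and> set xs \<subseteq> C \<longrightarrow> fop A f xs \<in> C)"

definition is_algebra :: "'f signature \<Rightarrow> ('f, 'a) algebra \<Rightarrow> bool" where
  "is_algebra sg A \<longleftrightarrow> universe A \<noteq> {} \<and> closed_under sg A (universe A)"

definition is_hom ::
  "'f signature \<Rightarrow> ('f, 'a) algebra \<Rightarrow> ('f, 'b) algebra \<Rightarrow> ('a \<Rightarrow> 'b) \<Rightarrow> bool" where
  "is_hom sg A B h \<longleftrightarrow>
     h ` universe A \<subseteq> universe B \<and>
     (\<forall>f xs. sg f = Some (length xs) \<and> set xs \<subseteq> universe A \<longrightarrow>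
        h (fop A f xs) = fop B f (map h xs))"

definition isomorphic ::
  "'f signature \<Rightarrow> ('f, 'a) algebra \<Rightarrow> ('f, 'b) algebra \<Rightarrow> bool" where
  "isomorphic sg A B \<longleftrightarrow>
     (\<exists>h. is_hom sg A B h \<and> bij_betw h (universe A) (universe B))"

definition subalgebra ::
  "'f signature \<Rightarrow> ('f, 'a) algebra \<Rightarrow> ('f, 'a) algebra \<Rightarrow> bool" where
  "subalgebra sg B A \<longleftrightarrow>
     is_algebra sg B \<and> universe B \<subseteq> universe A \<and>
     (\<forall>f xs. sg f = Some (length xs) \<and> set xs \<subseteq> universe B \<longrightarrow> fop B f xs = fop A f xs)"

definition generated :: "'f signature \<Rightarrow> ('f, 'a) algebra \<Rightarrow> 'a set \<Rightarrow> 'a set" where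
  "generated sg A G = \<Inter>{C. G \<subseteq> C \<and> C \<subseteq> universe A \<and> closed_under sg A C}"

definition finitely_generated :: "'f signature \<Rightarrow> ('f, 'a) algebra \<Rightarrow> bool" where
  "finitely_generated sg A \<longleftrightarrow>
     (\<exists>G. finite G \<and> G \<subseteq> universe A \<and> generated sg A G = universe A)"

definition congruence :: "'f signature \<Rightarrow> ('f, 'a) algebra \<Rightarrow> 'a rel \<Rightarrow> bool" where
  "congruence sg A \<theta> \<longleftrightarrow>
     equiv (universe A) \<theta> \<and>
     (\<forall>f xs ys. sg f = Some (length xs) \<and> list_all2 (\<lambda>x y. (x, y) \<in> \<theta>) xs ys \<longrightarrow>
        (fop A f xs, fop A f ys) \<in> \<theta>)"

definition quotient_algebra :: "('f, 'a) algebra \<Rightarrow> 'a rel \<Rightarrow> ('f, 'a set) algebra" where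
  "quotient_algebra A \<theta> =
     \<lparr>universe = universe A // \<theta>,
      fop = (\<lambda>f Xs. \<theta> `` {fop A f (map (\<lambda>X. SOME x. x \<in> X) Xs)})\<rparr>"

definition product_algebra :: "'i set \<Rightarrow> ('i \<Rightarrow> ('f, 'a) algebra) \<Rightarrow> ('f, 'i \<Rightarrow> 'a) algebra" where
  "product_algebra I A =
     \<lparr>universe = (\<Pi>\<^sub>E i\<in>I. universe (A i)),
      fop = (\<lambda>f xs. \<lambda>i\<in>I. fop (A i) f (map (\<lambda>x. x i) xs))\<rparr>"

definition ultrafilter_on :: "'i set \<Rightarrow> 'i set set \<Rightarrow> bool" where
  "ultrafilter_on I U \<longleftrightarrow>
     U \<subseteq> Pow I \<and> I \<in> U \<and> {} \<notin> U \<and>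
     (\<forall>X\<in>U. \<forall>Y\<in>U. X \<inter> Y \<in> U) \<and>
     (\<forall>X\<in>U. \<forall>Y. X \<subseteq> Y \<and> Y \<subseteq> I \<longrightarrow> Y \<in> U) \<and>
     (\<forall>X. X \<subseteq> I \<longrightarrow> X \<in> U \<or> I - X \<in> U)"

definition ultraproduct ::
  "'i set \<Rightarrow> 'i set set \<Rightarrow> ('i \<Rightarrow> ('f, 'a) algebra) \<Rightarrow> ('f, ('i \<Rightarrow> 'a) set) algebra" where
  "ultraproduct I U A =
     quotient_algebra (product_algebra I A)
       {(x, y). x \<in> universe (product_algebra I A) \<and> y \<in> universe (product_algebra I A) \<and>
                {i\<in>I. x i = y i} \<in> U}"


section \<open>Class operators\<close>

definition op_I :: "'f signature \<Rightarrow> ('f, 'a) algebra set \<Rightarrow> ('f, 'b) algebra set" where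
  "op_I sg K = {B. is_algebra sg B \<and> (\<exists>A\<in>K. isomorphic sg A B)}"

definition op_H :: "'f signature \<Rightarrow> ('f, 'a) algebra set \<Rightarrow> ('f, 'b) algebra set" where
  "op_H sg K =
     {B. is_algebra sg B \<and> (\<exists>A\<in>K. \<exists>h. is_hom sg A B h \<and> h ` universe A = universe B)}"

definition op_S :: "'f signature \<Rightarrow> ('f, 'a) algebra set \<Rightarrow> ('f, 'a) algebra set" where
  "op_S sg K = {B. \<exists>A\<in>K. subalgebra sg B A}"

text \<open>The empty family is admitted in products, so every quasivariety contains the trivial
  algebras.\<close>

definition op_P :: "('f, 'a) algebra set \<Rightarrow> ('f, 'i \<Rightarrow> 'a) algebra set" where
  "op_P K = {B. \<exists>(I :: 'i set) A. (\<forall>i\<in>I. A i \<in> K) \<and> B = product_algebra I A}"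

definition op_Pu :: "('f, 'a) algebra set \<Rightarrow> ('f, ('i \<Rightarrow> 'a) set) algebra set" where
  "op_Pu K =
     {B. \<exists>(I :: 'i set) U A.
           ultrafilter_on I U \<and> (\<forall>i\<in>I. A i \<in> K) \<and> B = ultraproduct I U A}"

text \<open>A class of algebras is a set of algebras whose universes are subsets of one infinite type
  \<open>'u\<close>, i.e. the part of the class consisting of algebras with at most \<open>|'u|\<close> elements (up to
  isomorphism). Products and ultraproducts live in larger types; \<open>op_I\<close> and \<open>op_H\<close> bring the
  algebras that are small enough back to \<open>'u\<close>. It suffices to index families by subsets of \<open>'u\<close>:
  for a finite signature an algebra on \<open>'u\<close> that satisfies all quasi-identities of \<open>K\<close>
  embeds in a product, over pairs of its elements, of ultraproducts indexed by the finite
  subsets of its diagram; and one that satisfies all identities of \<open>K\<close> is an image of a relatively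
  free algebra embedded in a product indexed by pairs of terms. Both index sets have at most
  \<open>|'u|\<close> elements, so larger index sets would give nothing new on \<open>'u\<close>. A quasivariety is
  determined by its countable members, so nothing is lost by restricting to \<open>'u\<close>.\<close>

definition ISPPu :: "'f signature \<Rightarrow> ('f, 'u) algebra set \<Rightarrow> ('f, 'u) algebra set" where
  "ISPPu sg K =
     op_I sg (op_S sg
       (op_P (op_Pu K :: ('f, ('u \<Rightarrow> 'u) set) algebra set)
          :: ('f, 'u \<Rightarrow> ('u \<Rightarrow> 'u) set) algebra set))"

definition op_V :: "'f signature \<Rightarrow> ('f, 'u) algebra set \<Rightarrow> ('f, 'u) algebra set" where
  "op_V sg K = op_H sg (op_S sg (op_P K :: ('f, 'u \<Rightarrow> 'u) algebra set))"

definition quasivariety :: "'f signature \<Rightarrow> ('f, 'u) algebra set \<Rightarrow> bool" where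
  "quasivariety sg Q \<longleftrightarrow> Q = ISPPu sg Q"


section \<open>Relative congruences and finite presentability\<close>

text \<open>\<open>A\<close> need not live on the type \<open>'u\<close> of the members of \<open>Q\<close>: an algebra on another
  type belongs to \<open>Q\<close> if it is in \<open>op_I sg Q\<close>. The quotient \<open>A/\<theta>\<close>, for instance, lives on
  \<open>'a set\<close>.\<close>

definition ConQ :: "'f signature \<Rightarrow> ('f, 'u) algebra set \<Rightarrow> ('f, 'a) algebra \<Rightarrow> 'a rel set" where
  "ConQ sg Q A = {\<theta>. congruence sg A \<theta> \<and> quotient_algebra A \<theta> \<in> op_I sg Q}"

definition Q_irreducible :: "'f signature \<Rightarrow> ('f, 'u) algebra set \<Rightarrow> ('f, 'u) algebra \<Rightarrow> bool" where
  "Q_irreducible sg Q A \<longleftrightarrow>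
     A \<in> Q \<and>
     (\<exists>a\<in>universe A. \<exists>b\<in>universe A. a \<noteq> b \<and>
        (\<forall>\<theta>\<in>ConQ sg Q A. \<theta> \<noteq> Id_on (universe A) \<longrightarrow> (a, b) \<in> \<theta>))"

datatype ('f, 'v) trm = Var 'v | App 'f "('f, 'v) trm list"

inductive_set terms :: "'f signature \<Rightarrow> 'v set \<Rightarrow> ('f, 'v) trm set"
  for sg :: "'f signature" and X :: "'v set" where
  Var: "x \<in> X \<Longrightarrow> Var x \<in> terms sg X"
| App: "\<lbrakk>sg f = Some (length ts); \<forall>t\<in>set ts. t \<in> terms sg X\<rbrakk> \<Longrightarrow> App f ts \<in> terms sg X"

definition term_algebra :: "'f signature \<Rightarrow> 'v set \<Rightarrow> ('f, ('f, 'v) trm) algebra" where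
  "term_algebra sg X = \<lparr>universe = terms sg X, fop = App\<rparr>"

text \<open>\<open>free_cong sg Q X\<close> identifies exactly those terms over \<open>X\<close> that are equal in all members
  of \<open>Q\<close>. If \<open>X\<close> is empty and there are no constants, there is no free algebra on \<open>X\<close>;
  then \<open>free_algebra sg Q X\<close> has empty universe and is isomorphic to no algebra.\<close>

definition free_cong ::
  "'f signature \<Rightarrow> ('f, 'u) algebra set \<Rightarrow> 'v set \<Rightarrow> ('f, 'v) trm rel" where
  "free_cong sg Q X = \<Inter>(ConQ sg Q (term_algebra sg X))"

definition free_algebra ::
  "'f signature \<Rightarrow> ('f, 'u) algebra set \<Rightarrow> 'v set \<Rightarrow> ('f, ('f, 'v) trm set) algebra" where
  "free_algebra sg Q X = quotient_algebra (term_algebra sg X) (free_cong sg Q X)"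

definition pres_cong ::
  "'f signature \<Rightarrow> ('f, 'u) algebra set \<Rightarrow> 'v set \<Rightarrow> ('f, 'v) trm rel \<Rightarrow> ('f, 'v) trm set rel" where
  "pres_cong sg Q X \<Sigma> =
     (LEAST \<theta>. \<theta> \<in> ConQ sg Q (free_algebra sg Q X) \<and>
        (\<forall>(p, q)\<in>\<Sigma>. (free_cong sg Q X `` {p}, free_cong sg Q X `` {q}) \<in> \<theta>))"

definition finitely_presented ::
  "'f signature \<Rightarrow> ('f, 'u) algebra set \<Rightarrow> ('f, 'u) algebra \<Rightarrow> bool" where
  "finitely_presented sg Q A \<longleftrightarrow>
     A \<in> Q \<and>
     (\<exists>(X :: nat set) \<Sigma>. finite X \<and> finite \<Sigma> \<and> \<Sigma> \<subseteq> terms sg X \<times> terms sg X \<and>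
        isomorphic sg A (quotient_algebra (free_algebra sg Q X) (pres_cong sg Q X \<Sigma>)))"

definition tame :: "'f signature \<Rightarrow> ('f, 'u) algebra set \<Rightarrow> bool" where
  "tame sg Q \<longleftrightarrow> (\<forall>A\<in>Q. finitely_generated sg A \<longrightarrow> finitely_presented sg Q A)"


section \<open>Primitivity and weak projectivity\<close>

definition equational_relative ::
  "'f signature \<Rightarrow> ('f, 'u) algebra set \<Rightarrow> ('f, 'u) algebra set \<Rightarrow> bool" where
  "equational_relative sg Q K \<longleftrightarrow> K = op_V sg K \<inter> Q"

definition primitive :: "'f signature \<Rightarrow> ('f, 'u) algebra set \<Rightarrow> bool" where
  "primitive sg Q \<longleftrightarrow>
     (\<forall>K. quasivariety sg K \<and> K \<subseteq> Q \<longrightarrow> equational_relative sg Q K)"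

definition omitting ::
  "'f signature \<Rightarrow> ('f, 'u) algebra set \<Rightarrow> ('f, 'u) algebra \<Rightarrow> ('f, 'u) algebra set" where
  "omitting sg Q A = {B\<in>Q. A \<notin> op_I sg (op_S sg {B})}"

definition weakly_projective ::
  "'f signature \<Rightarrow> ('f, 'u) algebra set \<Rightarrow> ('f, 'u) algebra \<Rightarrow> bool" where
  "weakly_projective sg K A \<longleftrightarrow>
     (\<forall>B\<in>K. A \<in> op_H sg {B} \<longrightarrow> A \<in> op_I sg (op_S sg {B}))"

definition fg_members :: "'f signature \<Rightarrow> ('f, 'u) algebra set \<Rightarrow> ('f, 'u) algebra set" where
  "fg_members sg Q = {A\<in>Q. finitely_generated sg A}"

text \<open>\<open>omitting sg Q A\<close> is the intended notion only for \<open>Q\<close>-irreducible \<open>A\<close>: for other \<open>A\<close> it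
  need not be closed under products (over the empty signature the sets without a 3-element subset
  are not, although all sets form a primitive tame quasivariety), and for trivial \<open>A\<close> it omits all
  algebras having a one-element subalgebra, whereas \<open>op_V\<close> of any class contains the trivial
  algebras. The next lemma records that the condition \<open>equational_relative sg Q (omitting sg Q A)\<close>
  fails for some finitely generated \<open>A \<in> Q\<close> in every quasivariety, so it can characterise
  primitivity only when restricted to \<open>Q\<close>-irreducible algebras.\<close>

lemma omitting_not_equational_relative:
  fixes Q :: "('f, 'u) algebra set"
  assumes "quasivariety sg Q"
  shows "\<exists>A\<in>Q. finitely_generated sg A \<and> \<not> equational_relative sg Q (omitting sg Q A)"
proof -
  define A :: "('f, 'u) algebra" where "A = \<lparr>universe = {undefined}, fop = (\<lambda>_ _. undefined)\<rparr>"
  have alg: "is_algebra sg A"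
    by (auto simp: is_algebra_def closed_under_def A_def)
  have unit: "is_algebra sg (product_algebra {} F)"
    "universe (product_algebra {} F) = {\<lambda>_. undefined}" for F :: "'i \<Rightarrow> ('f, 'a) algebra"
    by (auto simp: is_algebra_def closed_under_def product_algebra_def)
  have hom: "is_hom sg (product_algebra {} F) A (\<lambda>_. undefined)"
    for F :: "'i \<Rightarrow> ('f, 'a) algebra"
    by (auto simp: is_hom_def A_def)
  have iso: "isomorphic sg (product_algebra {} F) A" for F :: "'i \<Rightarrow> ('f, 'a) algebra"
    unfolding isomorphic_def
    by (intro exI[of _ "\<lambda>_. undefined"] conjI hom) (simp add: unit(2) A_def bij_betw_def)
  have sub: "subalgebra sg B B" if "is_algebra sg B" for B :: "('f, 'b) algebra"
    using that by (auto simp: subalgebra_def)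
  have mem: "product_algebra {} (\<lambda>_. undefined) \<in> op_S sg (op_P K)" for K :: "('f, 'a) algebra set"
    unfolding op_S_def op_P_def using sub[OF unit(1)] by blast
  have "A \<in> ISPPu sg Q"
    unfolding ISPPu_def op_I_def
    using alg iso by (intro CollectI conjI bexI[OF _ mem])
  then have AQ: "A \<in> Q"
    using assms by (simp add: quasivariety_def)
  have AV: "A \<in> op_V sg K" for K :: "('f, 'u) algebra set"
    unfolding op_V_def op_H_def
    using alg by (intro CollectI conjI bexI[OF _ mem] exI[of _ "\<lambda>_. undefined"] hom)
      (simp_all only: unit(2), simp add: A_def)
  have "isomorphic sg A A"
    unfolding isomorphic_def by (rule exI[of _ id]) (auto simp: is_hom_def A_def)
  then have "A \<notin> omitting sg Q A"
    using alg sub[OF alg] by (auto simp: omitting_def op_I_def op_S_def)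
  then have "\<not> equational_relative sg Q (omitting sg Q A)"
    using AQ AV by (auto simp: equational_relative_def)
  moreover have "finitely_generated sg A"
    unfolding finitely_generated_def generated_def
    by (rule exI[of _ "universe A"]) (use alg in \<open>auto simp: is_algebra_def A_def\<close>)
  ultimately show ?thesis
    using AQ by blast
qed

end

theory Submission
  imports Defs "HOL-Library.Countable_Set"
begin

text \<open>The implications from equational omitting classes to weak projectivity and from there to
  weak projectivity among the finitely generated members are direct: if \<open>A\<close> is an image but
  not a subalgebra of \<open>B \<in> Q\<close>, then \<open>B\<close> omits \<open>A\<close> while the variety generated by \<open>B\<close>
  contains it. The other two implications carry the content.

  From primitivity to equational omitting classes, it suffices that the members of \<open>Q\<close> omitting
  a finitely generated \<open>Q\<close>-irreducible \<open>A\<close> form a quasivariety (\<open>quasivariety_omitting\<close>). By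
  tameness \<open>A\<close> is finitely presented, so the defining relations of \<open>A\<close> together with the
  inequality of its critical pair form a finite condition. If it is satisfied in a product of
  ultraproducts, it is satisfied in one of the factors
  (\<open>finitely_presented_separated_in_factor\<close>), and by irreducibility a homomorphism into
  a member of \<open>Q\<close> that separates the critical pair is an embedding.

  From weak projectivity to primitivity, let \<open>K\<close> be a subquasivariety and \<open>A \<in> Q\<close> an image of a
  subalgebra \<open>B\<close> of a product of members of \<open>K\<close>. Every finitely generated subalgebra of \<open>A\<close> is
  separated by its \<open>Q\<close>-irreducible images (\<open>separating_irreducible_image\<close>). Such an image is also
  an image of a finitely generated subalgebra of \<open>B\<close>, hence embeds in it by weak projectivity and
  belongs to \<open>K\<close>. So \<open>A\<close> is locally separated by members of \<open>K\<close>
  (\<open>variety_members_of_subquasivariety\<close>).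

  Both directions rest on one compactness principle, \<open>locally_separated_mem\<close>: an algebra belongs
  to a quasivariety of finite type as soon as any two of its points can be separated by a map
  into a member that respects the operations on a prescribed finite set of arguments. It replaces
  the first-order axiomatisation by quasi-identities, and it makes relative congruences closed
  under intersections and unions of chains. The first closure property gives the least
  congruences in the definition of a finite presentation, the second the maximal ones in the
  decomposition into irreducible algebras.

  Since all members of a class live on the type \<open>'u\<close>, algebras on other types enter only
  together with an injection of their universe into \<open>'u\<close>. For term algebras and finitely
  generated subalgebras of products it exists because they are countable. So the infinity of
  \<open>'u\<close> and the finiteness of the signature serve twice: here, and for the compactness principle,
  whose ultraproducts are indexed by finite subsets.\<close>

section \<open>Index sets and ultrafilters\<close>

lemma infinite_pairing:
  assumes "infinite (UNIV :: 'u set)"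
  obtains p :: "'u \<times> 'u \<Rightarrow> 'u" where "inj p"
proof -
  obtain p :: "'u \<times> 'u \<Rightarrow> 'u" where "bij_betw p (UNIV \<times> UNIV) UNIV"
    using card_of_Times_same_infinite[OF assms] card_of_ordIso by blast
  then have "inj p"
    by (simp add: bij_betw_def)
  then show thesis
    by (rule that)
qed

text \<open>Iterating a pairing function codes the lists of each fixed length; pairing the code with
  the length makes the coding injective on all lists, and a finite set is coded by one of its
  enumerations.\<close>

lemma infinite_code_finite_sets:
  assumes "infinite (UNIV :: 'u set)"
  obtains c :: "'u set \<Rightarrow> 'u" where "inj_on c (Collect finite)"
proof -
  obtain p :: "'u \<times> 'u \<Rightarrow> 'u" where p: "inj p"
    using infinite_pairing[OF assms] .
  obtain n :: "nat \<Rightarrow> 'u" where n: "inj n"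
    using assms infinite_countable_subset by blast
  define e :: "'u list \<Rightarrow> 'u" where "e xs = foldr (\<lambda>x y. p (x, y)) xs undefined" for xs
  have e_inj: "xs = ys" if "length xs = length ys" "e xs = e ys" for xs ys
    using that
    by (induction xs ys rule: list_induct2) (auto simp: e_def inj_eq[OF p])
  define s :: "'u set \<Rightarrow> 'u list" where "s S = (SOME xs. set xs = S)" for S
  have s: "set (s S) = S" if "finite S" for S
    unfolding s_def using finite_list[OF that] by (rule someI_ex)
  have "inj_on (\<lambda>S. p (n (length (s S)), e (s S))) (Collect finite)"
  proof (rule inj_onI)
    fix S T :: "'u set"
    assume fin: "S \<in> Collect finite" "T \<in> Collect finite"
      and eq: "p (n (length (s S)), e (s S)) = p (n (length (s T)), e (s T))"
    from eq have "length (s S) = length (s T)" "e (s S) = e (s T)"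
      by (auto simp: inj_eq[OF p] inj_eq[OF n])
    then have "s S = s T"
      by (rule e_inj)
    then show "S = T"
      using fin s by (metis mem_Collect_eq)
  qed
  then show thesis
    by (rule that)
qed

lemma countable_inj_infinite:
  assumes "infinite (UNIV :: 'u set)" and "countable A"
  obtains \<iota> :: "'a \<Rightarrow> 'u" where "inj_on \<iota> A"
proof -
  obtain n :: "nat \<Rightarrow> 'u" where n: "inj n"
    using assms(1) infinite_countable_subset by blast
  have "inj_on (n \<circ> to_nat_on A) A"
    using inj_on_to_nat_on[OF assms(2)] inj_on_subset[OF n subset_UNIV] by (rule comp_inj_on)
  then show thesis
    by (rule that)
qed

text \<open>A family with the finite intersection property that is maximal with this property is an
  ultrafilter: if neither \<open>X\<close> nor \<open>I - X\<close> could be added to it, then two of its finite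
  subfamilies would have intersections disjoint from \<open>X\<close> and from \<open>I - X\<close>, hence their union
  would have empty intersection.\<close>

lemma ultrafilter_extending:
  assumes FI: "F \<subseteq> Pow I"
    and fip: "\<And>H. finite H \<Longrightarrow> H \<subseteq> F \<Longrightarrow> I \<inter> \<Inter>H \<noteq> {}"
  obtains U where "ultrafilter_on I U" and "F \<subseteq> U"
proof -
  define FF where "FF = {G. F \<subseteq> G \<and> G \<subseteq> Pow I \<and> (\<forall>H. finite H \<and> H \<subseteq> G \<longrightarrow> I \<inter> \<Inter>H \<noteq> {})}"
  have "\<exists>M\<in>FF. \<forall>X\<in>FF. M \<subseteq> X \<longrightarrow> X = M"
  proof (rule subset_Zorn_nonempty)
    have "F \<in> FF"
      unfolding FF_def using FI fip by blast
    then show "FF \<noteq> {}" by blast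
    fix C assume C: "C \<noteq> {}" "subset.chain FF C"
    have "I \<inter> \<Inter>H \<noteq> {}" if H: "finite H" "H \<subseteq> \<Union>C" for H
    proof -
      obtain B where "B \<in> C" "H \<subseteq> B"
        using finite_subset_Union_chain[OF H C] .
      then show ?thesis
        using C(2) H(1) unfolding subset_chain_def FF_def by blast
    qed
    moreover have "F \<subseteq> G \<and> G \<subseteq> Pow I" if "G \<in> C" for G
      using C(2) that unfolding subset_chain_def FF_def by blast
    then have "F \<subseteq> \<Union>C \<and> \<Union>C \<subseteq> Pow I"
      using C(1) by blast
    ultimately show "\<Union>C \<in> FF"
      unfolding FF_def by blast
  qed
  then obtain U where U: "U \<in> FF" and max: "\<And>X. X \<in> FF \<Longrightarrow> U \<subseteq> X \<Longrightarrow> X = U"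
    by blast
  have UF: "F \<subseteq> U" "U \<subseteq> Pow I" and Ufip: "\<And>H. finite H \<Longrightarrow> H \<subseteq> U \<Longrightarrow> I \<inter> \<Inter>H \<noteq> {}"
    using U unfolding FF_def by blast+
  have mem: "X \<in> U" if X: "X \<subseteq> I" and XH: "\<And>H. finite H \<Longrightarrow> H \<subseteq> U \<Longrightarrow> I \<inter> X \<inter> \<Inter>H \<noteq> {}" for X
  proof -
    have "I \<inter> \<Inter>H \<noteq> {}" if H: "finite H" "H \<subseteq> insert X U" for H
    proof -
      have "finite (H - {X})" "H - {X} \<subseteq> U"
        using H by auto
      then have "I \<inter> X \<inter> \<Inter>(H - {X}) \<noteq> {}"
        by (rule XH)
      then show ?thesis by blast
    qed
    then have "insert X U \<in> FF"
      using UF X unfolding FF_def by blast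
    from max[OF this] show ?thesis by blast
  qed
  have "ultrafilter_on I U"
    unfolding ultrafilter_on_def
  proof (intro conjI ballI allI impI)
    show "U \<subseteq> Pow I" by (rule UF)
    show "I \<in> U"
      using Ufip by (intro mem) auto
    show "{} \<notin> U"
      using Ufip[of "{{}}"] by auto
  next
    fix X Y assume "X \<in> U" "Y \<in> U"
    show "X \<inter> Y \<in> U"
    proof (rule mem)
      show "X \<inter> Y \<subseteq> I"
        using UF \<open>X \<in> U\<close> by blast
      fix H assume "finite H" "H \<subseteq> U"
      then have "I \<inter> \<Inter>(insert X (insert Y H)) \<noteq> {}"
        using \<open>X \<in> U\<close> \<open>Y \<in> U\<close> by (intro Ufip) auto
      then show "I \<inter> (X \<inter> Y) \<inter> \<Inter>H \<noteq> {}" by auto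
    qed
  next
    fix X Y assume "X \<in> U" and Y: "X \<subseteq> Y \<and> Y \<subseteq> I"
    show "Y \<in> U"
    proof (rule mem)
      fix H assume "finite H" "H \<subseteq> U"
      then have "I \<inter> \<Inter>(insert X H) \<noteq> {}"
        using \<open>X \<in> U\<close> by (intro Ufip) auto
      then show "I \<inter> Y \<inter> \<Inter>H \<noteq> {}"
        using Y by auto
    qed (use Y in auto)
  next
    fix X assume X: "X \<subseteq> I"
    show "X \<in> U \<or> I - X \<in> U"
    proof (rule ccontr)
      assume neg: "\<not> (X \<in> U \<or> I - X \<in> U)"
      have "\<exists>H. finite H \<and> H \<subseteq> U \<and> I \<inter> X \<inter> \<Inter>H = {}"
        using neg X mem[of X] by blast
      moreover have "\<exists>H. finite H \<and> H \<subseteq> U \<and> I \<inter> (I - X) \<inter> \<Inter>H = {}"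
        using neg mem[of "I - X"] by blast
      ultimately obtain H H' where "finite H" "H \<subseteq> U" "I \<inter> X \<inter> \<Inter>H = {}"
        and "finite H'" "H' \<subseteq> U" "I \<inter> (I - X) \<inter> \<Inter>H' = {}"
        by blast
      then have "finite (H \<union> H')" "H \<union> H' \<subseteq> U" "I \<inter> (\<Inter>H \<inter> \<Inter>H') = {}"
        by blast+
      then show False
        using Ufip[of "H \<union> H'"] by (simp add: Inter_Un_distrib)
    qed
  qed
  then show thesis
    using UF(1) by (rule that)
qed

section \<open>Homomorphisms, subalgebras and products\<close>

lemma closed_underI:
  "(\<And>f xs. sg f = Some (length xs) \<Longrightarrow> set xs \<subseteq> C \<Longrightarrow> fop A f xs \<in> C) \<Longrightarrow> closed_under sg A C"
  by (auto simp: closed_under_def)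

lemma closed_underD:
  "closed_under sg A C \<Longrightarrow> sg f = Some (length xs) \<Longrightarrow> set xs \<subseteq> C \<Longrightarrow> fop A f xs \<in> C"
  by (auto simp: closed_under_def)

lemma is_homI:
  assumes "\<And>x. x \<in> universe A \<Longrightarrow> h x \<in> universe B"
    and "\<And>f xs. sg f = Some (length xs) \<Longrightarrow> set xs \<subseteq> universe A \<Longrightarrow>
           h (fop A f xs) = fop B f (map h xs)"
  shows "is_hom sg A B h"
  using assms by (auto simp: is_hom_def)

lemma is_hom_op:
  "is_hom sg A B h \<Longrightarrow> sg f = Some (length xs) \<Longrightarrow> set xs \<subseteq> universe A \<Longrightarrow>
    h (fop A f xs) = fop B f (map h xs)"
  by (auto simp: is_hom_def)

lemma is_hom_mem: "is_hom sg A B h \<Longrightarrow> x \<in> universe A \<Longrightarrow> h x \<in> universe B"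
  by (auto simp: is_hom_def)

lemma is_hom_id: "is_hom sg A A (\<lambda>x. x)"
  by (auto simp: is_hom_def)

lemma is_hom_comp:
  assumes "is_hom sg A B h" and "is_hom sg B C k"
  shows "is_hom sg A C (\<lambda>x. k (h x))"
proof (rule is_homI)
  fix f xs assume f: "sg f = Some (length xs)" and xs: "set xs \<subseteq> universe A"
  have "set (map h xs) \<subseteq> universe B"
    using xs assms(1) by (auto simp: is_hom_def)
  then show "k (h (fop A f xs)) = fop C f (map (\<lambda>x. k (h x)) xs)"
    using f is_hom_op[OF assms(1) f xs] is_hom_op[OF assms(2), of f "map h xs"]
    by (simp add: comp_def)
qed (intro is_hom_mem[OF assms(2)] is_hom_mem[OF assms(1)])

lemma image_list_preimage:
  assumes "set ys \<subseteq> h ` C"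
  obtains xs where "set xs \<subseteq> C" and "ys = map h xs"
proof -
  have "ys \<in> map h ` lists C"
    using assms by (auto simp: lists_image[symmetric])
  then show thesis
    using that by (auto simp: lists_eq_set)
qed

lemma is_algebra_subuniverse:
  "closed_under sg A C \<Longrightarrow> C \<noteq> {} \<Longrightarrow> is_algebra sg (A\<lparr>universe := C\<rparr>)"
  by (auto simp: is_algebra_def closed_under_def)

lemma is_hom_subuniverse:
  "is_hom sg A B h \<Longrightarrow> C \<subseteq> universe A \<Longrightarrow> h ` C \<subseteq> D \<Longrightarrow>
    is_hom sg (A\<lparr>universe := C\<rparr>) (B\<lparr>universe := D\<rparr>) h"
  by (auto simp: is_hom_def)

lemma is_hom_into_superalgebra:
  assumes "subalgebra sg B D" and "is_hom sg A B h"
  shows "is_hom sg A D h"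
proof (rule is_homI)
  fix f xs assume f: "sg f = Some (length xs)" and xs: "set xs \<subseteq> universe A"
  have "set (map h xs) \<subseteq> universe B"
    using xs assms(2) by (auto simp: is_hom_def)
  then have "fop B f (map h xs) = fop D f (map h xs)"
    using assms(1) f by (simp add: subalgebra_def)
  then show "h (fop A f xs) = fop D f (map h xs)"
    using is_hom_op[OF assms(2) f xs] by simp
qed (use assms in \<open>auto simp: is_hom_def subalgebra_def\<close>)

lemma closed_under_hom_image:
  assumes h: "is_hom sg A B h" and C: "closed_under sg A C" "C \<subseteq> universe A"
  shows "closed_under sg B (h ` C)"
proof (rule closed_underI)
  fix f ys assume f: "sg f = Some (length ys)" and ys: "set ys \<subseteq> h ` C"
  obtain xs where xs: "set xs \<subseteq> C" "ys = map h xs"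
    using image_list_preimage[OF ys] .
  then have "fop B f ys = h (fop A f xs)"
    using is_hom_op[OF h] f C(2) by (metis length_map subset_trans)
  moreover have "fop A f xs \<in> C"
    using closed_underD[OF C(1)] f xs by simp
  ultimately show "fop B f ys \<in> h ` C"
    by simp
qed

lemma hom_inverse:
  assumes h: "is_hom sg A B h" and bij: "bij_betw h (universe A) (universe B)" and A: "is_algebra sg A"
  shows "is_hom sg B A (the_inv_into (universe A) h)"
    and "bij_betw (the_inv_into (universe A) h) (universe B) (universe A)"
proof -
  show *: "bij_betw (the_inv_into (universe A) h) (universe B) (universe A)"
    using bij by (rule bij_betw_the_inv_into)
  show "is_hom sg B A (the_inv_into (universe A) h)"
  proof (rule is_homI)
    fix f ys assume f: "sg f = Some (length ys)" and "set ys \<subseteq> universe B"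
    then have ys: "set ys \<subseteq> h ` universe A"
      using bij by (simp add: bij_betw_def)
    obtain xs where xs: "set xs \<subseteq> universe A" "ys = map h xs"
      using image_list_preimage[OF ys] .
    have inj: "inj_on h (universe A)"
      using bij by (simp add: bij_betw_def)
    have "map (the_inv_into (universe A) h) ys = xs"
      using xs inj by (auto simp: the_inv_into_f_f subset_iff intro!: map_idI)
    moreover have "fop B f ys = h (fop A f xs)"
      using is_hom_op[OF h] f xs by simp
    moreover have "fop A f xs \<in> universe A"
      using A f xs by (auto simp: is_algebra_def closed_under_def)
    ultimately show "the_inv_into (universe A) h (fop B f ys) =
        fop A f (map (the_inv_into (universe A) h) ys)"
      using inj by (simp add: the_inv_into_f_f)
  qed (use * in \<open>auto simp: bij_betw_def\<close>)
qed

lemma isomorphic_sym: "isomorphic sg A B \<Longrightarrow> is_algebra sg A \<Longrightarrow> isomorphic sg B A"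
  unfolding isomorphic_def using hom_inverse by blast

lemma isomorphic_trans:
  assumes "isomorphic sg A B" and "isomorphic sg B C"
  shows "isomorphic sg A C"
proof -
  obtain h k where h: "is_hom sg A B h" "bij_betw h (universe A) (universe B)"
    and k: "is_hom sg B C k" "bij_betw k (universe B) (universe C)"
    using assms by (auto simp: isomorphic_def)
  have "bij_betw (\<lambda>x. k (h x)) (universe A) (universe C)"
    using bij_betw_trans[OF h(2) k(2)] by (simp add: comp_def)
  then show ?thesis
    using is_hom_comp[OF h(1) k(1)] by (auto simp: isomorphic_def)
qed

lemma isomorphic_hom_image:
  assumes h: "is_hom sg A B h" and inj: "inj_on h (universe A)"
  shows "isomorphic sg A (B\<lparr>universe := h ` universe A\<rparr>)"
  unfolding isomorphic_def
  using h inj by (intro exI[of _ h]) (auto simp: is_hom_def bij_betw_def)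

lemma is_algebra_hom_image:
  assumes h: "is_hom sg A B h" and A: "is_algebra sg A"
  shows "is_algebra sg (B\<lparr>universe := h ` universe A\<rparr>)"
  using A closed_under_hom_image[OF h, of "universe A"]
  by (intro is_algebra_subuniverse) (auto simp: is_algebra_def)

lemma op_IS_iff_embedding:
  fixes A :: "('f, 'a) algebra" and K :: "('f, 'b) algebra set"
  assumes A: "is_algebra sg A"
  shows "A \<in> op_I sg (op_S sg K) \<longleftrightarrow>
    (\<exists>B\<in>K. \<exists>h. is_hom sg A B h \<and> inj_on h (universe A))"
proof
  assume "A \<in> op_I sg (op_S sg K)"
  then obtain B D where B: "B \<in> K" and D: "subalgebra sg D B" and iso: "isomorphic sg D A"
    by (auto simp: op_I_def op_S_def)
  have "isomorphic sg A D"
    using isomorphic_sym[OF iso] D by (simp add: subalgebra_def)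
  then obtain h where "is_hom sg A D h" "bij_betw h (universe A) (universe D)"
    by (auto simp: isomorphic_def)
  then show "\<exists>B\<in>K. \<exists>h. is_hom sg A B h \<and> inj_on h (universe A)"
    using B is_hom_into_superalgebra[OF D] by (auto simp: bij_betw_def)
next
  assume "\<exists>B\<in>K. \<exists>h. is_hom sg A B h \<and> inj_on h (universe A)"
  then obtain B h where B: "B \<in> K" and h: "is_hom sg A B h" and inj: "inj_on h (universe A)"
    by blast
  let ?D = "B\<lparr>universe := h ` universe A\<rparr>"
  have D: "is_algebra sg ?D"
    using h A by (rule is_algebra_hom_image)
  have "subalgebra sg ?D B"
    using D is_hom_mem[OF h] by (auto simp: subalgebra_def)
  moreover have "isomorphic sg ?D A"
    using isomorphic_hom_image[OF h inj] A by (rule isomorphic_sym)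
  ultimately show "A \<in> op_I sg (op_S sg K)"
    using A B by (auto simp: op_I_def op_S_def)
qed

lemma op_I_mono: "K \<subseteq> L \<Longrightarrow> op_I sg K \<subseteq> op_I sg L"
  by (auto simp: op_I_def)

text \<open>The homomorphism theorem, stated with a second homomorphism in place of the quotient.\<close>

lemma hom_factor:
  assumes p: "is_hom sg T A p" "p ` universe T = universe A"
    and g: "is_hom sg T B g" and T: "is_algebra sg T"
    and ker: "\<And>x y. x \<in> universe T \<Longrightarrow> y \<in> universe T \<Longrightarrow> p x = p y \<Longrightarrow> g x = g y"
  obtains k where "is_hom sg A B k" and "\<And>x. x \<in> universe T \<Longrightarrow> k (p x) = g x"
proof -
  define k where "k y = g (SOME x. x \<in> universe T \<and> p x = y)" for y
  have k: "k (p x) = g x" if "x \<in> universe T" for x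
  proof -
    let ?x = "SOME x'. x' \<in> universe T \<and> p x' = p x"
    have "?x \<in> universe T \<and> p ?x = p x"
      using that by (intro someI[of "\<lambda>x'. x' \<in> universe T \<and> p x' = p x" x]) simp
    then show ?thesis
      unfolding k_def using that by (intro ker) auto
  qed
  have "is_hom sg A B k"
  proof (rule is_homI)
    fix y assume "y \<in> universe A"
    then show "k y \<in> universe B"
      using k p(2) is_hom_mem[OF g] by force
  next
    fix f ys assume f: "sg f = Some (length ys)" and "set ys \<subseteq> universe A"
    then have ys: "set ys \<subseteq> p ` universe T"
      using p(2) by simp
    obtain xs where xs: "set xs \<subseteq> universe T" "ys = map p xs"
      using image_list_preimage[OF ys] .
    have "fop A f ys = p (fop T f xs)"
      using is_hom_op[OF p(1)] f xs by simp
    moreover have "fop T f xs \<in> universe T"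
      using T f xs by (auto simp: is_algebra_def closed_under_def)
    moreover have "g (fop T f xs) = fop B f (map g xs)"
      using is_hom_op[OF g] f xs by simp
    moreover have "map k ys = map g xs"
      using xs k by auto
    ultimately show "k (fop A f ys) = fop B f (map k ys)"
      using k by simp
  qed
  then show thesis
    using k by (rule that)
qed

lemma is_hom_projection:
  "j \<in> J \<Longrightarrow> is_hom sg (product_algebra J M) (M j) (\<lambda>x. x j)"
  by (auto simp: is_hom_def product_algebra_def)

lemma is_hom_into_product:
  assumes h: "\<And>j. j \<in> J \<Longrightarrow> is_hom sg A (M j) (h j)"
  shows "is_hom sg A (product_algebra J M) (\<lambda>x. \<lambda>j\<in>J. h j x)"
proof (rule is_homI)
  fix f xs assume f: "sg f = Some (length xs)" and xs: "set xs \<subseteq> universe A"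
  have "(\<lambda>j\<in>J. h j (fop A f xs)) = (\<lambda>j\<in>J. fop (M j) f (map (\<lambda>x. h j x) xs))"
    using is_hom_op[OF h f xs] by (intro restrict_ext) simp
  then show "(\<lambda>j\<in>J. h j (fop A f xs)) =
      fop (product_algebra J M) f (map (\<lambda>x. \<lambda>j\<in>J. h j x) xs)"
    by (auto simp: product_algebra_def comp_def)
qed (use is_hom_mem[OF h] in \<open>auto simp: product_algebra_def\<close>)

lemma closed_under_product:
  assumes "\<And>j. j \<in> J \<Longrightarrow> closed_under sg (M j) (universe (M j))"
  shows "closed_under sg (product_algebra J M) (universe (product_algebra J M))"
proof (rule closed_underI)
  fix f xs assume f: "sg f = Some (length xs)" and xs: "set xs \<subseteq> universe (product_algebra J M)"
  have "fop (M j) f (map (\<lambda>x. x j) xs) \<in> universe (M j)" if "j \<in> J" for j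
    using f xs that by (intro closed_underD[OF assms[OF that]]) (auto simp: product_algebra_def)
  then show "fop (product_algebra J M) f xs \<in> universe (product_algebra J M)"
    by (auto simp: product_algebra_def)
qed


section \<open>Congruences and quotients\<close>

lemma congruence_class_hom:
  assumes cong: "congruence sg A \<theta>" and A: "closed_under sg A (universe A)"
  shows "is_hom sg A (quotient_algebra A \<theta>) (\<lambda>x. \<theta> `` {x})"
proof (rule is_homI)
  fix f xs assume f: "sg f = Some (length xs)" and xs: "set xs \<subseteq> universe A"
  have eq: "equiv (universe A) \<theta>"
    using cong by (simp add: congruence_def)
  let ?r = "\<lambda>x. SOME y. y \<in> \<theta> `` {x}"
  have "(x, ?r x) \<in> \<theta>" if "x \<in> universe A" for x
  proof -
    have "x \<in> \<theta> `` {x}"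
      using eq that by (rule equiv_class_self)
    then have "?r x \<in> \<theta> `` {x}"
      by (rule someI)
    then show ?thesis by simp
  qed
  then have "list_all2 (\<lambda>x y. (x, y) \<in> \<theta>) xs (map ?r xs)"
    using xs by (auto simp: list_all2_conv_all_nth subset_iff)
  then have "(fop A f xs, fop A f (map ?r xs)) \<in> \<theta>"
    using cong f unfolding congruence_def by blast
  then have "\<theta> `` {fop A f xs} = \<theta> `` {fop A f (map ?r xs)}"
    by (rule equiv_class_eq[OF eq])
  then show "\<theta> `` {fop A f xs} = fop (quotient_algebra A \<theta>) f (map (\<lambda>x. \<theta> `` {x}) xs)"
    by (simp add: quotient_algebra_def comp_def)
qed (auto simp: quotient_algebra_def quotientI)

lemma quotient_surj: "(\<lambda>x. \<theta> `` {x}) ` universe A = universe (quotient_algebra A \<theta>)"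
  by (auto simp: quotient_algebra_def quotient_def)

lemma is_algebra_quotient:
  assumes "congruence sg A \<theta>" and "is_algebra sg A"
  shows "is_algebra sg (quotient_algebra A \<theta>)"
proof -
  have A: "closed_under sg A (universe A)" "universe A \<noteq> {}"
    using assms(2) by (auto simp: is_algebra_def)
  show ?thesis
    using closed_under_hom_image[OF congruence_class_hom[OF assms(1) A(1)] A(1) subset_refl] A(2)
    unfolding quotient_surj is_algebra_def by (metis quotient_surj image_is_empty)
qed

definition hom_kernel :: "('f, 'a) algebra \<Rightarrow> ('a \<Rightarrow> 'b) \<Rightarrow> 'a rel" where
  "hom_kernel A h = {(x, y). x \<in> universe A \<and> y \<in> universe A \<and> h x = h y}"

lemma congruence_hom_kernel:
  assumes h: "is_hom sg A B h" and A: "closed_under sg A (universe A)"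
  shows "congruence sg A (hom_kernel A h)"
  unfolding congruence_def
proof (intro conjI allI impI)
  show "equiv (universe A) (hom_kernel A h)"
    by (rule equivI) (auto simp: hom_kernel_def refl_on_def sym_def trans_def)
  fix f xs ys
  assume "sg f = Some (length xs) \<and> list_all2 (\<lambda>x y. (x, y) \<in> hom_kernel A h) xs ys"
  then have f: "sg f = Some (length xs)" "sg f = Some (length ys)"
    and xy: "list_all2 (\<lambda>x y. (x, y) \<in> hom_kernel A h) xs ys"
    by (auto dest: list_all2_lengthD)
  have sub: "set xs \<subseteq> universe A" "set ys \<subseteq> universe A" "map h xs = map h ys"
    using xy by (induction xs ys rule: list_all2_induct) (auto simp: hom_kernel_def)
  have "h (fop A f xs) = h (fop A f ys)"
    using is_hom_op[OF h f(1) sub(1)] is_hom_op[OF h f(2) sub(2)] sub(3) by simp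
  then show "(fop A f xs, fop A f ys) \<in> hom_kernel A h"
    using closed_underD[OF A f(1) sub(1)] closed_underD[OF A f(2) sub(2)]
    by (simp add: hom_kernel_def)
qed

text \<open>The canonical map of a product onto its ultraproduct, together with its kernel: later
  arguments compare coordinates of representatives and never look at equivalence classes.\<close>

lemma ultraproduct_class_hom:
  fixes I :: "'i set" and M :: "'i \<Rightarrow> ('f, 'a) algebra"
  assumes U: "ultrafilter_on I U" and M: "\<And>i. i \<in> I \<Longrightarrow> closed_under sg (M i) (universe (M i))"
  obtains p where "is_hom sg (product_algebra I M) (ultraproduct I U M) p"
    and "p ` universe (product_algebra I M) = universe (ultraproduct I U M)"
    and "\<And>x y. x \<in> universe (product_algebra I M) \<Longrightarrow> y \<in> universe (product_algebra I M) \<Longrightarrow>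
           p x = p y \<longleftrightarrow> {i\<in>I. x i = y i} \<in> U"
proof -
  let ?P = "product_algebra I M"
  define \<theta> where "\<theta> = {(x, y). x \<in> universe ?P \<and> y \<in> universe ?P \<and> {i\<in>I. x i = y i} \<in> U}"
  have up: "X \<in> U \<Longrightarrow> X \<subseteq> Y \<Longrightarrow> Y \<subseteq> I \<Longrightarrow> Y \<in> U"
    and int: "X \<in> U \<Longrightarrow> Y \<in> U \<Longrightarrow> X \<inter> Y \<in> U" and IU: "I \<in> U" for X Y
    using U unfolding ultrafilter_on_def by blast+
  have fin: "I \<inter> \<Inter>(X ` set zs) \<in> U" if "\<And>z. z \<in> set zs \<Longrightarrow> X z \<in> U" for X and zs :: "'z list"
    using that
  proof (induction zs)
    case (Cons z zs)
    have "I \<inter> \<Inter>(X ` set zs) \<in> U"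
      using Cons.prems by (intro Cons.IH) simp
    moreover have "X z \<in> U"
      using Cons.prems by simp
    ultimately have "X z \<inter> (I \<inter> \<Inter>(X ` set zs)) \<in> U"
      by (intro int[of "X z"])
    then show ?case
      by (simp add: Int_left_commute)
  qed (simp add: IU)
  have closed: "closed_under sg ?P (universe ?P)"
    using M by (rule closed_under_product)
  have equiv: "equiv (universe ?P) \<theta>"
  proof (rule equivI)
    show "sym \<theta>"
      by (auto simp: \<theta>_def sym_def eq_commute)
    show "refl_on (universe ?P) \<theta>"
      using IU by (auto simp: \<theta>_def refl_on_def)
    show "trans \<theta>"
    proof (rule transI)
      fix x y z assume xy: "(x, y) \<in> \<theta>" and yz: "(y, z) \<in> \<theta>"
      then have "{i\<in>I. x i = y i} \<inter> {i\<in>I. y i = z i} \<in> U"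
        by (intro int) (auto simp: \<theta>_def)
      then have "{i\<in>I. x i = z i} \<in> U"
        by (rule up) auto
      then show "(x, z) \<in> \<theta>"
        using xy yz by (auto simp: \<theta>_def)
    qed
  qed (auto simp: \<theta>_def)
  have cong: "congruence sg ?P \<theta>"
    unfolding congruence_def
  proof (intro conjI allI impI equiv)
    fix f xs ys assume fxy: "sg f = Some (length xs) \<and> list_all2 (\<lambda>x y. (x, y) \<in> \<theta>) xs ys"
    then have f: "sg f = Some (length xs)" "sg f = Some (length ys)"
      by (auto dest: list_all2_lengthD)
    have rel: "(x, y) \<in> \<theta>" if "(x, y) \<in> set (zip xs ys)" for x y
      using fxy that by (auto simp: list_all2_iff)
    have sub: "set xs \<subseteq> universe ?P" "set ys \<subseteq> universe ?P"
      using fxy by (auto simp: list_all2_conv_all_nth in_set_conv_nth \<theta>_def)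
    have "I \<inter> \<Inter>((\<lambda>(x, y). {i\<in>I. x i = y i}) ` set (zip xs ys)) \<in> U"
      using rel by (intro fin) (auto simp: \<theta>_def)
    then have "{i\<in>I. fop ?P f xs i = fop ?P f ys i} \<in> U"
    proof (rule up)
      show "I \<inter> \<Inter>((\<lambda>(x, y). {i\<in>I. x i = y i}) ` set (zip xs ys)) \<subseteq>
          {i\<in>I. fop ?P f xs i = fop ?P f ys i}"
      proof
        fix i assume i: "i \<in> I \<inter> \<Inter>((\<lambda>(x, y). {i\<in>I. x i = y i}) ` set (zip xs ys))"
        then have "list_all2 (\<lambda>x y. x i = y i) xs ys"
          using f by (auto simp: list_all2_iff)
        then have "map (\<lambda>x. x i) xs = map (\<lambda>x. x i) ys"
          by (simp add: list_all2_eq list_all2_map1 list_all2_map2)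
        then show "i \<in> {i\<in>I. fop ?P f xs i = fop ?P f ys i}"
          using i by (simp add: product_algebra_def)
      qed
    qed auto
    then show "(fop ?P f xs, fop ?P f ys) \<in> \<theta>"
      using closed_underD[OF closed f(1) sub(1)] closed_underD[OF closed f(2) sub(2)]
      by (simp add: \<theta>_def)
  qed
  have eq: "ultraproduct I U M = quotient_algebra ?P \<theta>"
    by (simp add: ultraproduct_def \<theta>_def)
  show thesis
  proof (rule that)
    show "is_hom sg ?P (ultraproduct I U M) (\<lambda>x. \<theta> `` {x})"
      unfolding eq using cong closed by (rule congruence_class_hom)
    show "(\<lambda>x. \<theta> `` {x}) ` universe ?P = universe (ultraproduct I U M)"
      unfolding eq by (rule quotient_surj)
    fix x y assume "x \<in> universe ?P" "y \<in> universe ?P"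
    then show "\<theta> `` {x} = \<theta> `` {y} \<longleftrightarrow> {i\<in>I. x i = y i} \<in> U"
      using eq_equiv_class_iff[OF equiv] by (simp add: \<theta>_def)
  qed
qed


section \<open>Local embeddability and relative congruences\<close>

text \<open>The maps \<open>g i\<close> need not be homomorphisms: it suffices that each single instance of an
  operation is preserved at almost all indices.\<close>

lemma locally_hom_into_ultraproduct:
  fixes I :: "'i set" and M :: "'i \<Rightarrow> ('f, 'b) algebra" and A :: "('f, 'a) algebra"
  assumes U: "ultrafilter_on I U" and M: "\<And>i. i \<in> I \<Longrightarrow> closed_under sg (M i) (universe (M i))"
    and A: "closed_under sg A (universe A)"
    and g: "\<And>i. i \<in> I \<Longrightarrow> g i ` universe A \<subseteq> universe (M i)"
    and op: "\<And>f xs. sg f = Some (length xs) \<Longrightarrow> set xs \<subseteq> universe A \<Longrightarrow>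
               {i\<in>I. g i (fop A f xs) = fop (M i) f (map (g i) xs)} \<in> U"
  obtains h where "is_hom sg A (ultraproduct I U M) h"
    and "\<And>x y. x \<in> universe A \<Longrightarrow> y \<in> universe A \<Longrightarrow> h x = h y \<longleftrightarrow> {i\<in>I. g i x = g i y} \<in> U"
proof -
  let ?P = "product_algebra I M"
  obtain p where p: "is_hom sg ?P (ultraproduct I U M) p"
    and "p ` universe ?P = universe (ultraproduct I U M)"
    and p_eq: "\<And>x y. x \<in> universe ?P \<Longrightarrow> y \<in> universe ?P \<Longrightarrow> p x = p y \<longleftrightarrow> {i\<in>I. x i = y i} \<in> U"
    using ultraproduct_class_hom[where M = M and sg = sg, OF U M] by blast
  let ?G = "\<lambda>x. \<lambda>i\<in>I. g i x"
  have G: "?G x \<in> universe ?P" if "x \<in> universe A" for x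
    using g that by (auto simp: product_algebra_def)
  have sep: "p (?G x) = p (?G y) \<longleftrightarrow> {i\<in>I. g i x = g i y} \<in> U"
    if "x \<in> universe A" "y \<in> universe A" for x y
  proof -
    have "{i\<in>I. ?G x i = ?G y i} = {i\<in>I. g i x = g i y}"
      by auto
    then show ?thesis
      using p_eq[OF G[OF that(1)] G[OF that(2)]] by simp
  qed
  have "is_hom sg A (ultraproduct I U M) (\<lambda>x. p (?G x))"
  proof (rule is_homI)
    fix f xs assume f: "sg f = Some (length xs)" and xs: "set xs \<subseteq> universe A"
    have sub: "set (map ?G xs) \<subseteq> universe ?P"
      using xs G by auto
    have mem: "fop A f xs \<in> universe A"
      using A f xs by (rule closed_underD)
    have memP: "fop ?P f (map ?G xs) \<in> universe ?P"
      using f sub by (intro closed_underD[OF closed_under_product[OF M]]) auto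
    have "{i\<in>I. ?G (fop A f xs) i = fop ?P f (map ?G xs) i} =
        {i\<in>I. g i (fop A f xs) = fop (M i) f (map (g i) xs)}"
      by (auto simp: product_algebra_def comp_def)
    then have "p (?G (fop A f xs)) = p (fop ?P f (map ?G xs))"
      using p_eq[OF G[OF mem] memP] op[OF f xs] by simp
    also have "\<dots> = fop (ultraproduct I U M) f (map p (map ?G xs))"
      using f sub by (intro is_hom_op[OF p]) auto
    finally show "p (?G (fop A f xs)) = fop (ultraproduct I U M) f (map (\<lambda>x. p (?G x)) xs)"
      by (simp add: comp_def)
  qed (intro is_hom_mem[OF p] G)
  then show thesis
    using sep by (rule that)
qed

lemma isomorphic_copy:
  fixes A :: "('f, 'a) algebra" and \<iota> :: "'a \<Rightarrow> 'u"
  assumes A: "is_algebra sg A" and \<iota>: "inj_on \<iota> (universe A)"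
  obtains A' :: "('f, 'u) algebra" where "is_algebra sg A'" and "isomorphic sg A A'"
proof -
  let ?j = "the_inv_into (universe A) \<iota>"
  let ?A' = "\<lparr>universe = \<iota> ` universe A, fop = (\<lambda>f xs. \<iota> (fop A f (map ?j xs)))\<rparr> :: ('f, 'u) algebra"
  have hom: "is_hom sg A ?A' \<iota>"
  proof (rule is_homI)
    fix f xs assume "set xs \<subseteq> universe A"
    then have "map ?j (map \<iota> xs) = xs"
      using \<iota> by (auto simp: the_inv_into_f_f subset_iff intro!: map_idI)
    then show "\<iota> (fop A f xs) = fop ?A' f (map \<iota> xs)"
      by simp
  qed simp
  have "is_algebra sg ?A'"
    using is_algebra_hom_image[OF hom A] by simp
  moreover have "isomorphic sg A ?A'"
    using isomorphic_hom_image[OF hom \<iota>] by simp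
  ultimately show thesis
    by (rule that)
qed

lemma ultrafilter_on_superset:
  "ultrafilter_on I U \<Longrightarrow> X \<in> U \<Longrightarrow> X \<subseteq> Y \<Longrightarrow> Y \<subseteq> I \<Longrightarrow> Y \<in> U"
  unfolding ultrafilter_on_def by blast

locale finite_type_quasivariety =
  fixes sg :: "'f signature" and Q :: "('f, 'u) algebra set"
  assumes infinite_carrier: "infinite (UNIV :: 'u set)"
    and finite_type: "finite (dom sg)"
    and quasivariety: "quasivariety sg Q"
begin

lemma member_is_algebra: "B \<in> Q \<Longrightarrow> is_algebra sg B"
  using quasivariety unfolding quasivariety_def ISPPu_def op_I_def by blast

lemma member_closed: "B \<in> Q \<Longrightarrow> closed_under sg B (universe B)"
  using member_is_algebra by (simp add: is_algebra_def)

text \<open>This turns closure under ultraproducts into a finitary criterion. Index an ultraproduct by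
  the finite subsets of \<open>A\<close>, with an ultrafilter containing all sets of the form
  \<open>{T. S \<subseteq> T}\<close>: for every operation symbol and all arguments the maps separating \<open>a\<close> from
  \<open>b\<close> preserve that operation instance at almost all indices, so together they form a
  homomorphism of \<open>A\<close> into the ultraproduct. Running through all pairs \<open>a \<noteq> b\<close> embeds \<open>A\<close> into a product of
  ultraproducts. Closure of \<open>Q\<close> under subalgebras, products and directed unions of
  congruences are all instances.\<close>

lemma locally_separated_mem:
  fixes A :: "('f, 'a) algebra" and \<iota> :: "'a \<Rightarrow> 'u"
  assumes A: "is_algebra sg A" and \<iota>: "inj_on \<iota> (universe A)"
    and sep: "\<And>S a b. finite S \<Longrightarrow> S \<subseteq> universe A \<Longrightarrow> a \<in> universe A \<Longrightarrow> b \<in> universe A \<Longrightarrow> a \<noteq> b \<Longrightarrow>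
      \<exists>B\<in>Q. \<exists>g. g ` universe A \<subseteq> universe B \<and> g a \<noteq> g b \<and>
        (\<forall>f xs. sg f = Some (length xs) \<and> set xs \<subseteq> S \<longrightarrow> g (fop A f xs) = fop B f (map g xs))"
  shows "A \<in> op_I sg Q"
proof -
  obtain c :: "'u set \<Rightarrow> 'u" where c: "inj_on c (Collect finite)"
    using infinite_code_finite_sets[OF infinite_carrier] .
  obtain p :: "'u \<times> 'u \<Rightarrow> 'u" where p: "inj p"
    using infinite_pairing[OF infinite_carrier] .
  \<comment> \<open>Families are indexed by elements of \<open>'u\<close>, so finite subsets of \<open>A\<close>, and below pairs of
    elements of \<open>A\<close>, are replaced by codes.\<close>
  define Fin where "Fin = {S. finite S \<and> S \<subseteq> universe A}"
  define k where "k S = c (\<iota> ` S)" for S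
  define I where "I = k ` Fin"
  define D where "D = the_inv_into Fin k"
  have "inj_on k Fin"
  proof (rule inj_onI)
    fix S T assume ST: "S \<in> Fin" "T \<in> Fin" and "k S = k T"
    then have "\<iota> ` S = \<iota> ` T"
      using inj_onD[OF c, of "\<iota> ` S" "\<iota> ` T"] by (simp add: k_def Fin_def)
    then show "S = T"
      using inj_on_image_eq_iff[OF \<iota>] ST by (simp add: Fin_def)
  qed
  then have D: "D (k S) = S" if "S \<in> Fin" for S
    unfolding D_def using that by (rule the_inv_into_f_f)
  define F where "F = (\<lambda>S. {i\<in>I. S \<subseteq> D i}) ` Fin"
  have "I \<inter> \<Inter>H \<noteq> {}" if H: "finite H" "H \<subseteq> F" for H
  proof -
    obtain T where T: "T \<subseteq> Fin" "finite T" "H = (\<lambda>S. {i\<in>I. S \<subseteq> D i}) ` T"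
      using finite_subset_image[OF H[unfolded F_def]] by blast
    have "\<Union>T \<in> Fin"
      using T by (auto simp: Fin_def)
    then have "k (\<Union>T) \<in> I \<inter> \<Inter>H"
      using D T(3) by (auto simp: I_def)
    then show ?thesis by blast
  qed
  moreover have "F \<subseteq> Pow I"
    by (auto simp: F_def)
  ultimately obtain U where U: "ultrafilter_on I U" and FU: "F \<subseteq> U"
    using ultrafilter_extending by metis
  define T where "T = {(a, b). a \<in> universe A \<and> b \<in> universe A \<and> a \<noteq> b}"
  have "\<forall>t\<in>T \<times> I. \<exists>Bg. fst Bg \<in> Q \<and> snd Bg ` universe A \<subseteq> universe (fst Bg) \<and>
      snd Bg (fst (fst t)) \<noteq> snd Bg (snd (fst t)) \<and>
      (\<forall>f xs. sg f = Some (length xs) \<and> set xs \<subseteq> D (snd t) \<longrightarrow>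
        snd Bg (fop A f xs) = fop (fst Bg) f (map (snd Bg) xs))"
    (is "\<forall>t\<in>_. \<exists>Bg. ?sep t Bg")
  proof
    fix t assume "t \<in> T \<times> I"
    then obtain a b S where t: "t = ((a, b), k S)" and S: "S \<in> Fin"
      and ab: "a \<in> universe A" "b \<in> universe A" "a \<noteq> b"
      by (auto simp: T_def I_def)
    obtain B g where "B \<in> Q" "g ` universe A \<subseteq> universe B" "g a \<noteq> g b"
      "\<forall>f xs. sg f = Some (length xs) \<and> set xs \<subseteq> S \<longrightarrow> g (fop A f xs) = fop B f (map g xs)"
      using sep[of S a b] S ab unfolding Fin_def by blast
    then have "?sep t (B, g)"
      using S by (simp add: t D)
    then show "\<exists>Bg. ?sep t Bg" ..
  qed
  from bchoice[OF this] obtain Bg where Bg: "\<forall>t\<in>T \<times> I. fst (Bg t) \<in> Q \<and>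
      snd (Bg t) ` universe A \<subseteq> universe (fst (Bg t)) \<and>
      snd (Bg t) (fst (fst t)) \<noteq> snd (Bg t) (snd (fst t)) \<and>
      (\<forall>f xs. sg f = Some (length xs) \<and> set xs \<subseteq> D (snd t) \<longrightarrow>
        snd (Bg t) (fop A f xs) = fop (fst (Bg t)) f (map (snd (Bg t)) xs))"
    by blast
  define M where "M t = ultraproduct I U (\<lambda>i. fst (Bg (t, i)))" for t
  have A': "closed_under sg A (universe A)"
    using A by (simp add: is_algebra_def)
  have "\<exists>h. is_hom sg A (M t) h \<and> h (fst t) \<noteq> h (snd t)" if t: "t \<in> T" for t
  proof -
    have op: "{i\<in>I. snd (Bg (t, i)) (fop A f xs) = fop (fst (Bg (t, i))) f (map (snd (Bg (t, i))) xs)} \<in> U"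
      if f: "sg f = Some (length xs)" and xs: "set xs \<subseteq> universe A" for f xs
    proof -
      have "set xs \<in> Fin"
        using xs by (simp add: Fin_def)
      then have "{i\<in>I. set xs \<subseteq> D i} \<in> U"
        using FU by (auto simp: F_def)
      moreover have "{i\<in>I. set xs \<subseteq> D i} \<subseteq>
          {i\<in>I. snd (Bg (t, i)) (fop A f xs) = fop (fst (Bg (t, i))) f (map (snd (Bg (t, i))) xs)}"
        using Bg t f by auto
      ultimately show ?thesis
        by (rule ultrafilter_on_superset[OF U]) auto
    qed
    have closed: "closed_under sg (fst (Bg (t, i))) (universe (fst (Bg (t, i))))" if "i \<in> I" for i
      using Bg t that by (intro member_closed) auto
    have maps: "snd (Bg (t, i)) ` universe A \<subseteq> universe (fst (Bg (t, i)))" if "i \<in> I" for i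
      using bspec[OF Bg, of "(t, i)"] t that by simp
    obtain h where h: "is_hom sg A (M t) h"
      and h_eq: "\<And>x y. x \<in> universe A \<Longrightarrow> y \<in> universe A \<Longrightarrow>
        h x = h y \<longleftrightarrow> {i\<in>I. snd (Bg (t, i)) x = snd (Bg (t, i)) y} \<in> U"
      unfolding M_def
      using locally_hom_into_ultraproduct[where M = "\<lambda>i. fst (Bg (t, i))" and g = "\<lambda>i. snd (Bg (t, i))",
          OF U closed A' maps op] by blast
    have "{i\<in>I. snd (Bg (t, i)) (fst t) = snd (Bg (t, i)) (snd t)} = {}"
      using Bg t by auto
    then have "h (fst t) \<noteq> h (snd t)"
      using h_eq[of "fst t" "snd t"] t U by (auto simp: T_def ultrafilter_on_def)
    then show ?thesis
      using h by blast
  qed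
  then obtain h where h: "\<And>t. t \<in> T \<Longrightarrow> is_hom sg A (M t) (h t)"
    and h_sep: "\<And>t. t \<in> T \<Longrightarrow> h t (fst t) \<noteq> h t (snd t)"
    by metis
  define q where "q t = p (\<iota> (fst t), \<iota> (snd t))" for t
  define d where "d = the_inv_into T q"
  have "inj_on q T"
    using \<iota> by (intro inj_onI) (auto simp: q_def T_def inj_eq[OF p] dest: inj_onD)
  then have d: "d (q t) = t" if "t \<in> T" for t
    unfolding d_def using that by (rule the_inv_into_f_f)
  let ?P = "product_algebra (q ` T) (\<lambda>j. M (d j))"
  let ?e = "\<lambda>x. \<lambda>j\<in>q ` T. h (d j) x"
  have e: "is_hom sg A ?P ?e"
    using h d by (intro is_hom_into_product) auto
  have inj: "inj_on ?e (universe A)"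
  proof (rule inj_onI, rule ccontr)
    fix a b assume ab: "a \<in> universe A" "b \<in> universe A" "?e a = ?e b" "a \<noteq> b"
    then have "(a, b) \<in> T"
      by (simp add: T_def)
    with fun_cong[OF ab(3), of "q (a, b)"] h_sep[of "(a, b)"] d[of "(a, b)"] show False
      by simp
  qed
  have "M t \<in> op_Pu Q" if "t \<in> T" for t
    unfolding op_Pu_def M_def using U Bg that
    by (intro CollectI exI[of _ I] exI[of _ U] exI[of _ "\<lambda>i. fst (Bg (t, i))"]) auto
  then have P: "?P \<in> op_P (op_Pu Q)"
    unfolding op_P_def using d by (intro CollectI exI[of _ "q ` T"] exI[of _ "\<lambda>j. M (d j)"]) auto
  obtain A' :: "('f, 'u) algebra" where A': "is_algebra sg A'" and iso: "isomorphic sg A A'"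
    using isomorphic_copy[OF A \<iota>] .
  then have iso': "isomorphic sg A' A"
    using A isomorphic_sym by blast
  then obtain i where i: "is_hom sg A' A i" "bij_betw i (universe A') (universe A)"
    by (auto simp: isomorphic_def)
  have "inj_on (?e \<circ> i) (universe A')"
    using i(2) inj by (simp add: comp_inj_on bij_betw_def)
  then have "A' \<in> ISPPu sg Q"
    unfolding ISPPu_def op_IS_iff_embedding[OF A']
    using P is_hom_comp[OF i(1) e] by (auto simp: comp_def)
  then show ?thesis
    using iso' A quasivariety by (auto simp: quasivariety_def op_I_def)
qed

lemma embedding_mem:
  assumes "is_algebra sg A" and "is_hom sg A B h" and "inj_on h (universe A)" and "B \<in> Q"
  shows "A \<in> op_I sg Q"
proof (rule locally_separated_mem[OF assms(1,3)])
  fix S a b assume S: "S \<subseteq> universe A" and ab: "a \<in> universe A" "b \<in> universe A" "a \<noteq> b"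
  have "g (fop A f xs) = fop B f (map g xs)"
    if "g = h" "sg f = Some (length xs)" "set xs \<subseteq> S" for g f xs
    using is_hom_op[OF assms(2)] that S by auto
  moreover have "h a \<noteq> h b"
    using ab assms(3) by (auto dest: inj_onD)
  ultimately show "\<exists>B\<in>Q. \<exists>g. g ` universe A \<subseteq> universe B \<and> g a \<noteq> g b \<and>
      (\<forall>f xs. sg f = Some (length xs) \<and> set xs \<subseteq> S \<longrightarrow> g (fop A f xs) = fop B f (map g xs))"
    using assms(2,4) by (intro bexI[of _ B] exI[of _ h]) (auto simp: is_hom_def)
qed

text \<open>A relative congruence is the kernel of a homomorphism into a member of \<open>Q\<close>; this form
  avoids the quotient.\<close>

lemma ConQ_iff_kernel:
  assumes A: "is_algebra sg A"
  shows "\<theta> \<in> ConQ sg Q A \<longleftrightarrow> (\<exists>B\<in>Q. \<exists>h. is_hom sg A B h \<and> \<theta> = hom_kernel A h)"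
proof
  assume "\<theta> \<in> ConQ sg Q A"
  then have cong: "congruence sg A \<theta>" and "quotient_algebra A \<theta> \<in> op_I sg Q"
    by (auto simp: ConQ_def)
  then obtain B where B: "B \<in> Q" and iso: "isomorphic sg B (quotient_algebra A \<theta>)"
    by (auto simp: op_I_def)
  obtain k where k: "is_hom sg (quotient_algebra A \<theta>) B k" "inj_on k (universe (quotient_algebra A \<theta>))"
    using isomorphic_sym[OF iso member_is_algebra[OF B]] by (auto simp: isomorphic_def bij_betw_def)
  have p: "is_hom sg A (quotient_algebra A \<theta>) (\<lambda>x. \<theta> `` {x})"
    using cong A by (intro congruence_class_hom) (auto simp: is_algebra_def)
  have eq: "equiv (universe A) \<theta>"
    using cong by (simp add: congruence_def)
  have "k (\<theta> `` {x}) = k (\<theta> `` {y}) \<longleftrightarrow> (x, y) \<in> \<theta>" if "x \<in> universe A" "y \<in> universe A" for x y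
    using that eq_equiv_class_iff[OF eq that] is_hom_mem[OF p]
    by (auto simp: inj_on_eq_iff[OF k(2)])
  then have "\<theta> = hom_kernel A (\<lambda>x. k (\<theta> `` {x}))"
    using eq by (auto simp: hom_kernel_def equiv_def refl_on_def)
  then show "\<exists>B\<in>Q. \<exists>h. is_hom sg A B h \<and> \<theta> = hom_kernel A h"
    using B is_hom_comp[OF p k(1)] by blast
next
  assume "\<exists>B\<in>Q. \<exists>h. is_hom sg A B h \<and> \<theta> = hom_kernel A h"
  then obtain B h where B: "B \<in> Q" and h: "is_hom sg A B h" and \<theta>: "\<theta> = hom_kernel A h"
    by blast
  have closed: "closed_under sg A (universe A)"
    using A by (simp add: is_algebra_def)
  have cong: "congruence sg A \<theta>"
    unfolding \<theta> using h closed by (rule congruence_hom_kernel)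
  have eq: "equiv (universe A) \<theta>"
    using cong by (simp add: congruence_def)
  have p: "is_hom sg A (quotient_algebra A \<theta>) (\<lambda>x. \<theta> `` {x})"
    using cong closed by (rule congruence_class_hom)
  have ker: "\<theta> `` {x} = \<theta> `` {y} \<longleftrightarrow> h x = h y" if "x \<in> universe A" "y \<in> universe A" for x y
    using eq_equiv_class_iff[OF eq that] that by (simp add: \<theta> hom_kernel_def)
  obtain k where k: "is_hom sg (quotient_algebra A \<theta>) B k"
    and kp: "\<And>x. x \<in> universe A \<Longrightarrow> k (\<theta> `` {x}) = h x"
    by (rule hom_factor[OF p quotient_surj h A]) (simp_all only: ker)
  have "inj_on k (universe (quotient_algebra A \<theta>))"
    unfolding quotient_surj[symmetric]
  proof (rule inj_onI)
    fix X Y assume "X \<in> (\<lambda>x. \<theta> `` {x}) ` universe A" "Y \<in> (\<lambda>x. \<theta> `` {x}) ` universe A"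
      and eqk: "k X = k Y"
    then obtain x y where xy: "x \<in> universe A" "y \<in> universe A"
      and X: "X = \<theta> `` {x}" and Y: "Y = \<theta> `` {y}"
      by blast
    show "X = Y"
      using eqk unfolding X Y kp[OF xy(1)] kp[OF xy(2)] ker[OF xy] .
  qed
  then have "quotient_algebra A \<theta> \<in> op_I sg Q"
    using embedding_mem[OF is_algebra_quotient[OF cong A] k] B by blast
  then show "\<theta> \<in> ConQ sg Q A"
    using cong by (simp add: ConQ_def)
qed

text \<open>Only finitely many operations have to be respected on a finite set of classes, and each of
  them amounts to one pair in the congruence. Hence relative congruences that approximate
  \<open>\<theta>\<close> on finite sets of pairs locally separate the quotient by \<open>\<theta>\<close>.\<close>

lemma ConQ_locally:
  fixes A :: "('f, 'a) algebra" and \<iota> :: "'a \<Rightarrow> 'u"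
  assumes A: "is_algebra sg A" and \<iota>: "inj_on \<iota> (universe A)" and cong: "congruence sg A \<theta>"
    and approx: "\<And>R x y. finite R \<Longrightarrow> R \<subseteq> \<theta> \<Longrightarrow> x \<in> universe A \<Longrightarrow> y \<in> universe A \<Longrightarrow> (x, y) \<notin> \<theta> \<Longrightarrow>
      \<exists>\<psi>\<in>ConQ sg Q A. R \<subseteq> \<psi> \<and> (x, y) \<notin> \<psi>"
  shows "\<theta> \<in> ConQ sg Q A"
proof -
  let ?q = "quotient_algebra A \<theta>"
  have eq: "equiv (universe A) \<theta>"
    using cong by (simp add: congruence_def)
  have sub\<theta>: "\<theta> \<subseteq> universe A \<times> universe A"
    using eq by (simp add: equiv_def)
  define r :: "'a set \<Rightarrow> 'a" where "r = (\<lambda>X. SOME x. x \<in> X)"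
  have r: "r X \<in> X" "r X \<in> universe A" "\<theta> `` {r X} = X" if X: "X \<in> universe ?q" for X
  proof -
    obtain x where x: "x \<in> universe A" "X = \<theta> `` {x}"
      using X by (auto simp: quotient_algebra_def elim: quotientE)
    have "x \<in> X"
      unfolding x(2) using eq x(1) by (rule equiv_class_self)
    then show "r X \<in> X"
      unfolding r_def by (rule someI)
    then have "(x, r X) \<in> \<theta>"
      using x(2) by blast
    then show "r X \<in> universe A" "\<theta> `` {r X} = X"
      using sub\<theta> equiv_class_eq[OF eq, of x "r X"] x(2) by (blast, metis)
  qed
  have small: "inj_on (\<lambda>X. \<iota> (r X)) (universe ?q)"
    using r inj_onD[OF \<iota>] by (intro inj_onI) metis
  have qalg: "is_algebra sg ?q"
    using cong A by (rule is_algebra_quotient)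
  have "?q \<in> op_I sg Q"
  proof (rule locally_separated_mem[OF qalg small])
    fix S X Y assume S: "finite S" "S \<subseteq> universe ?q"
      and XY: "X \<in> universe ?q" "Y \<in> universe ?q" "X \<noteq> Y"
    define W where "W = (SIGMA f:dom sg. {Xs. set Xs \<subseteq> S \<and> length Xs = the (sg f)})"
    define R where "R = (\<lambda>(f, Xs). (fop A f (map r Xs), r (fop ?q f Xs))) ` W"
    have "finite W"
      unfolding W_def using finite_type S(1) by (intro finite_SigmaI finite_lists_length_eq)
    then have "finite R"
      by (simp add: R_def)
    moreover have "R \<subseteq> \<theta>"
    proof
      fix z assume "z \<in> R"
      then obtain f Xs where "(f, Xs) \<in> W" and z: "z = (fop A f (map r Xs), r (fop ?q f Xs))"
        unfolding R_def by (auto elim!: imageE)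
      then have f: "sg f = Some (length Xs)" and Xs: "set Xs \<subseteq> S"
        unfolding W_def by auto
      have "fop ?q f Xs \<in> universe ?q"
        using qalg f Xs S(2) by (auto simp: is_algebra_def closed_under_def)
      then have "r (fop ?q f Xs) \<in> fop ?q f Xs"
        by (rule r)
      moreover have "fop ?q f Xs = \<theta> `` {fop A f (map r Xs)}"
        by (simp add: quotient_algebra_def r_def)
      ultimately show "z \<in> \<theta>"
        using z by blast
    qed
    moreover have "(r X, r Y) \<notin> \<theta>"
    proof
      assume "(r X, r Y) \<in> \<theta>"
      then have "\<theta> `` {r X} = \<theta> `` {r Y}"
        by (rule equiv_class_eq[OF eq])
      then show False
        unfolding r(3)[OF XY(1)] r(3)[OF XY(2)] using XY(3) by contradiction
    qed
    ultimately obtain \<psi> where "\<psi> \<in> ConQ sg Q A" and \<psi>: "R \<subseteq> \<psi>" "(r X, r Y) \<notin> \<psi>"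
      using approx[OF _ _ r(2)[OF XY(1)] r(2)[OF XY(2)]] by blast
    then obtain B h where B: "B \<in> Q" and h: "is_hom sg A B h" and ker: "\<psi> = hom_kernel A h"
      using ConQ_iff_kernel[OF A] by blast
    let ?g = "\<lambda>X. h (r X)"
    have "?g ` universe ?q \<subseteq> universe B"
      using r is_hom_mem[OF h] by auto
    moreover have "?g X \<noteq> ?g Y"
      using \<psi>(2) r XY by (simp add: ker hom_kernel_def)
    moreover have "?g (fop ?q f Xs) = fop B f (map ?g Xs)"
      if f: "sg f = Some (length Xs)" and Xs: "set Xs \<subseteq> S" for f Xs
    proof -
      have "(f, Xs) \<in> W"
        using f Xs by (auto simp: W_def)
      then have "(fop A f (map r Xs), r (fop ?q f Xs)) \<in> \<psi>"
        using \<psi>(1) by (force simp: R_def)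
      then have "?g (fop ?q f Xs) = h (fop A f (map r Xs))"
        by (simp add: ker hom_kernel_def)
      also have "\<dots> = fop B f (map h (map r Xs))"
        using f Xs S(2) r by (intro is_hom_op[OF h]) auto
      finally show ?thesis
        by (simp add: comp_def)
    qed
    ultimately show "\<exists>B\<in>Q. \<exists>g. g ` universe ?q \<subseteq> universe B \<and> g X \<noteq> g Y \<and>
        (\<forall>f Xs. sg f = Some (length Xs) \<and> set Xs \<subseteq> S \<longrightarrow> g (fop ?q f Xs) = fop B f (map g Xs))"
      using B by (intro bexI[of _ B] exI[of _ ?g]) auto
  qed
  then show ?thesis
    using cong by (simp add: ConQ_def)
qed

lemma ConQ_total:
  assumes A: "is_algebra sg A" and \<iota>: "inj_on (\<iota> :: 'a \<Rightarrow> 'u) (universe A)"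
  shows "universe A \<times> universe A \<in> ConQ sg Q A"
proof (rule ConQ_locally[OF assms])
  have "hom_kernel A (\<lambda>_. undefined :: 'u) = universe A \<times> universe A"
    by (auto simp: hom_kernel_def)
  moreover have "congruence sg A (hom_kernel A (\<lambda>_. undefined :: 'u))"
    using A by (intro congruence_hom_kernel[where B = "\<lparr>universe = UNIV, fop = (\<lambda>_ _. undefined)\<rparr>"])
      (auto simp: is_hom_def is_algebra_def)
  ultimately show "congruence sg A (universe A \<times> universe A)"
    by simp
qed auto

lemma ConQ_Inter:
  assumes A: "is_algebra sg A" and \<iota>: "inj_on (\<iota> :: 'a \<Rightarrow> 'u) (universe A)"
    and C: "C \<subseteq> ConQ sg Q A" "C \<noteq> {}"
  shows "\<Inter>C \<in> ConQ sg Q A"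
proof (rule ConQ_locally[OF A \<iota>])
  have C': "congruence sg A \<theta>" if "\<theta> \<in> C" for \<theta>
    using C that by (auto simp: ConQ_def)
  show "congruence sg A (\<Inter>C)"
    unfolding congruence_def
  proof (intro conjI allI impI)
    have eqv: "equiv (universe A) \<theta>" if "\<theta> \<in> C" for \<theta>
      using C'[OF that] by (simp add: congruence_def)
    show "equiv (universe A) (\<Inter>C)"
    proof (rule equivI)
      show "\<Inter>C \<subseteq> universe A \<times> universe A"
        using eqv C(2) by (fastforce simp: equiv_def)
      show "refl_on (universe A) (\<Inter>C)"
        using eqv by (fastforce simp: equiv_def refl_on_def)
      show "sym (\<Inter>C)"
        using eqv by (fastforce simp: equiv_def sym_def)
      show "trans (\<Inter>C)"
        using eqv by (intro transI) (blast dest: equivE transD)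
    qed
    fix f xs ys
    assume f: "sg f = Some (length xs) \<and> list_all2 (\<lambda>x y. (x, y) \<in> \<Inter>C) xs ys"
    show "(fop A f xs, fop A f ys) \<in> \<Inter>C"
    proof
      fix \<theta> assume "\<theta> \<in> C"
      moreover from this have "list_all2 (\<lambda>x y. (x, y) \<in> \<theta>) xs ys"
        using f by (auto elim!: list_all2_mono)
      ultimately show "(fop A f xs, fop A f ys) \<in> \<theta>"
        using C'[of \<theta>] f unfolding congruence_def by blast
    qed
  qed
qed (use C in blast)

lemma ConQ_Union_chain:
  assumes A: "is_algebra sg A" and \<iota>: "inj_on (\<iota> :: 'a \<Rightarrow> 'u) (universe A)"
    and C: "subset.chain (ConQ sg Q A) C" "C \<noteq> {}"
  shows "\<Union>C \<in> ConQ sg Q A"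
proof (rule ConQ_locally[OF A \<iota>])
  have C': "congruence sg A \<theta>" if "\<theta> \<in> C" for \<theta>
    using C that by (auto simp: ConQ_def subset_chain_def)
  have upper: "\<exists>\<theta>\<in>C. R \<subseteq> \<theta>" if "finite R" "R \<subseteq> \<Union>C" for R
    using finite_subset_Union_chain[OF that C(2,1)] by blast
  show "congruence sg A (\<Union>C)"
    unfolding congruence_def
  proof (intro conjI allI impI)
    have eqv: "equiv (universe A) \<theta>" if "\<theta> \<in> C" for \<theta>
      using C'[OF that] by (simp add: congruence_def)
    show "equiv (universe A) (\<Union>C)"
    proof (rule equivI)
      show "\<Union>C \<subseteq> universe A \<times> universe A"
        using eqv by (fastforce simp: equiv_def)
      show "refl_on (universe A) (\<Union>C)"
        using eqv C(2) by (fastforce simp: equiv_def refl_on_def)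
      show "sym (\<Union>C)"
        using eqv by (fastforce simp: equiv_def sym_def)
      show "trans (\<Union>C)"
      proof (rule transI)
        fix x y z assume "(x, y) \<in> \<Union>C" "(y, z) \<in> \<Union>C"
        then obtain \<theta> where "\<theta> \<in> C" "(x, y) \<in> \<theta>" "(y, z) \<in> \<theta>"
          using upper[of "{(x, y), (y, z)}"] by auto
        then show "(x, z) \<in> \<Union>C"
          using eqv by (blast dest: equivE transD)
      qed
    qed
    fix f xs ys
    assume f: "sg f = Some (length xs) \<and> list_all2 (\<lambda>x y. (x, y) \<in> \<Union>C) xs ys"
    then have "set (zip xs ys) \<subseteq> \<Union>C"
      by (auto simp: list_all2_iff)
    then obtain \<theta> where \<theta>: "\<theta> \<in> C" "set (zip xs ys) \<subseteq> \<theta>"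
      using upper[of "set (zip xs ys)"] by auto
    then have "list_all2 (\<lambda>x y. (x, y) \<in> \<theta>) xs ys"
      using f by (auto simp: list_all2_iff)
    then show "(fop A f xs, fop A f ys) \<in> \<Union>C"
      using C'[OF \<theta>(1)] f \<theta>(1) unfolding congruence_def by blast
  qed
  fix R x y assume "finite R" "R \<subseteq> \<Union>C" "(x, y) \<notin> \<Union>C"
  then obtain \<theta> where "\<theta> \<in> C" "R \<subseteq> \<theta>"
    using upper by blast
  moreover from this have "(x, y) \<notin> \<theta>"
    using \<open>(x, y) \<notin> \<Union>C\<close> by blast
  ultimately show "\<exists>\<psi>\<in>ConQ sg Q A. R \<subseteq> \<psi> \<and> (x, y) \<notin> \<psi>"
    using C(1) by (auto simp: subset_chain_def)
qed

end


section \<open>Generation\<close>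

lemma generated_least:
  "C \<subseteq> universe A \<Longrightarrow> closed_under sg A C \<Longrightarrow> G \<subseteq> C \<Longrightarrow> generated sg A G \<subseteq> C"
  unfolding generated_def by blast

lemma generated_superset: "G \<subseteq> generated sg A G"
  unfolding generated_def by blast

lemma generated_subset_universe:
  "closed_under sg A (universe A) \<Longrightarrow> G \<subseteq> universe A \<Longrightarrow> generated sg A G \<subseteq> universe A"
  by (rule generated_least) auto

lemma closed_under_generated: "closed_under sg A (generated sg A G)"
proof (rule closed_underI)
  fix f xs assume f: "sg f = Some (length xs)" and xs: "set xs \<subseteq> generated sg A G"
  have "fop A f xs \<in> C" if "G \<subseteq> C" "C \<subseteq> universe A" "closed_under sg A C" for C
    using closed_underD[OF that(3) f] generated_least[OF that(2,3,1)] xs by blast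
  then show "fop A f xs \<in> generated sg A G"
    unfolding generated_def by blast
qed

lemma hom_image_generated_subset:
  assumes h: "is_hom sg A B h" and A: "closed_under sg A (universe A)"
    and C: "closed_under sg B C" and G: "G \<subseteq> universe A" "h ` G \<subseteq> C"
  shows "h ` generated sg A G \<subseteq> C"
proof -
  have "closed_under sg A {x \<in> universe A. h x \<in> C}"
  proof (rule closed_underI)
    fix f xs assume f: "sg f = Some (length xs)" and xs: "set xs \<subseteq> {x \<in> universe A. h x \<in> C}"
    then have sub: "set xs \<subseteq> universe A" by auto
    have "fop B f (map h xs) \<in> C"
      using f xs by (intro closed_underD[OF C]) auto
    then show "fop A f xs \<in> {x \<in> universe A. h x \<in> C}"
      using closed_underD[OF A f sub] is_hom_op[OF h f sub] by simp
  qed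
  then have "generated sg A G \<subseteq> {x \<in> universe A. h x \<in> C}"
    using G by (intro generated_least) auto
  then show ?thesis by blast
qed

lemma hom_image_generated:
  assumes h: "is_hom sg A B h" and A: "closed_under sg A (universe A)" and G: "G \<subseteq> universe A"
  shows "h ` generated sg A G = generated sg B (h ` G)"
proof
  show "h ` generated sg A G \<subseteq> generated sg B (h ` G)"
    using h A closed_under_generated G generated_superset by (rule hom_image_generated_subset)
  have sub: "generated sg A G \<subseteq> universe A"
    using A G by (rule generated_subset_universe)
  show "generated sg B (h ` G) \<subseteq> h ` generated sg A G"
  proof (rule generated_least)
    show "h ` generated sg A G \<subseteq> universe B"
      using sub is_hom_mem[OF h] by blast
    show "closed_under sg B (h ` generated sg A G)"
      using h closed_under_generated sub by (rule closed_under_hom_image)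
    show "h ` G \<subseteq> h ` generated sg A G"
      using generated_superset by (rule image_mono)
  qed
qed

lemma finitely_generated_hom_image:
  assumes "is_hom sg A B h" and "h ` universe A = universe B"
    and "closed_under sg A (universe A)" and "finitely_generated sg A"
  shows "finitely_generated sg B"
proof -
  obtain G where G: "finite G" "G \<subseteq> universe A" "generated sg A G = universe A"
    using assms(4) by (auto simp: finitely_generated_def)
  then have "generated sg B (h ` G) = universe B"
    using hom_image_generated[OF assms(1,3) G(2)] assms(2) by simp
  then show ?thesis
    unfolding finitely_generated_def using G(1) image_mono[OF G(2), of h] assms(2)
    by (intro exI[of _ "h ` G"]) simp
qed

lemma finitely_generated_subuniverse:
  assumes A: "closed_under sg A (universe A)" and G: "G \<subseteq> universe A" "finite G"
  shows "finitely_generated sg (A\<lparr>universe := generated sg A G\<rparr>)"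
proof -
  let ?C = "generated sg A G"
  have sub: "?C \<subseteq> universe A"
    using A G(1) by (rule generated_subset_universe)
  have "?C \<subseteq> D" if "G \<subseteq> D" "D \<subseteq> ?C" "closed_under sg (A\<lparr>universe := ?C\<rparr>) D" for D
    using that sub by (intro generated_least) (auto simp: closed_under_def)
  then have "generated sg (A\<lparr>universe := ?C\<rparr>) G = ?C"
    using generated_superset[of G sg A] closed_under_generated[of sg A G]
    unfolding generated_def[of sg "A\<lparr>universe := ?C\<rparr>"] by (auto simp: closed_under_def)
  then show ?thesis
    unfolding finitely_generated_def using G generated_superset[of G sg A]
    by (intro exI[of _ G]) auto
qed

text \<open>Countability is what gives term algebras, and finitely generated subalgebras of products, an
  isomorphic copy on any infinite type.\<close>

lemma countable_generated:
  assumes A: "closed_under sg A (universe A)" and G: "G \<subseteq> universe A" "countable G"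
    and sg: "finite (dom sg)"
  shows "countable (generated sg A G)"
proof -
  define step where "step C = C \<union> (\<lambda>(f, xs). fop A f xs) ` {(f, xs). sg f = Some (length xs) \<and> set xs \<subseteq> C}"
    for C
  define L where "L n = (step ^^ n) G" for n
  have L_Suc: "L (Suc n) = step (L n)" and L_0: "L 0 = G" for n
    by (simp_all add: L_def)
  have "countable (L n)" for n
  proof (induction n)
    case (Suc n)
    have "countable {(f, xs). sg f = Some (length xs) \<and> set xs \<subseteq> L n}"
    proof (rule countable_subset)
      show "{(f, xs). sg f = Some (length xs) \<and> set xs \<subseteq> L n} \<subseteq> dom sg \<times> lists (L n)"
        by auto
      show "countable (dom sg \<times> lists (L n))"
        using Suc countable_finite[OF sg] by (intro countable_SIGMA countable_lists)
    qed
    then show ?case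
      unfolding L_Suc step_def using Suc by simp
  qed (simp add: L_0 G)
  moreover have L_sub: "L n \<subseteq> universe A" for n
  proof (induction n)
    case (Suc n)
    then show ?case
      unfolding L_Suc step_def using closed_underD[OF A] by fastforce
  qed (simp add: L_0 G)
  moreover have "closed_under sg A (\<Union>n. L n)"
  proof (rule closed_underI)
    fix f xs assume f: "sg f = Some (length xs)" and xs: "set xs \<subseteq> (\<Union>n. L n)"
    have mono: "L m \<subseteq> L n" if "m \<le> n" for m n
      using that by (rule lift_Suc_mono_le[of L, rotated]) (auto simp: L_Suc step_def)
    have "\<exists>n. set xs \<subseteq> L n"
      using xs
    proof (induction xs)
      case (Cons x xs)
      then obtain m n where "set xs \<subseteq> L n" "x \<in> L m"
        by auto
      then have "set (x # xs) \<subseteq> L (max m n)"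
        using mono[of m "max m n"] mono[of n "max m n"] by auto
      then show ?case ..
    qed simp
    then obtain n where "set xs \<subseteq> L n" ..
    then have "fop A f xs \<in> L (Suc n)"
      using f by (force simp: L_Suc step_def)
    then show "fop A f xs \<in> (\<Union>n. L n)"
      by blast
  qed
  ultimately have "generated sg A G \<subseteq> (\<Union>n. L n)"
    using L_0 by (intro generated_least) auto
  then show ?thesis
    using \<open>\<And>n. countable (L n)\<close> by (meson countable_UN countableI_type countable_subset)
qed

lemma hom_eq_on_generated:
  assumes h: "is_hom sg A B h" and k: "is_hom sg A B k" and A: "closed_under sg A (universe A)"
    and G: "G \<subseteq> universe A" "\<And>x. x \<in> G \<Longrightarrow> h x = k x" and x: "x \<in> generated sg A G"
  shows "h x = k x"
proof -
  have "closed_under sg A {x \<in> universe A. h x = k x}"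
  proof (rule closed_underI)
    fix f xs assume f: "sg f = Some (length xs)" and xs: "set xs \<subseteq> {x \<in> universe A. h x = k x}"
    then have sub: "set xs \<subseteq> universe A" and eq: "map h xs = map k xs" by auto
    show "fop A f xs \<in> {x \<in> universe A. h x = k x}"
      using closed_underD[OF A f sub] is_hom_op[OF h f sub] is_hom_op[OF k f sub] eq by simp
  qed
  then have "generated sg A G \<subseteq> {x \<in> universe A. h x = k x}"
    using G by (intro generated_least) auto
  then show ?thesis
    using x by blast
qed


section \<open>Terms and finite presentations\<close>

lemma universe_term_algebra: "universe (term_algebra sg X) = terms sg X"
  by (simp add: term_algebra_def)

lemma closed_under_term_algebra: "closed_under sg (term_algebra sg X) (terms sg X)"
  by (auto simp: closed_under_def term_algebra_def intro!: terms.App)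

lemma term_algebra_generated: "generated sg (term_algebra sg X) (Var ` X) = terms sg X"
proof
  show "generated sg (term_algebra sg X) (Var ` X) \<subseteq> terms sg X"
    by (rule generated_least)
      (auto simp: universe_term_algebra closed_under_term_algebra intro: terms.Var)
  have "t \<in> generated sg (term_algebra sg X) (Var ` X)" if "t \<in> terms sg X" for t
    using that
  proof induction
    case (Var x)
    then show ?case
      using generated_superset[of "Var ` X"] by blast
  next
    case (App f ts)
    then have "fop (term_algebra sg X) f ts \<in> generated sg (term_algebra sg X) (Var ` X)"
      by (intro closed_underD[OF closed_under_generated]) auto
    then show ?case
      by (simp add: term_algebra_def)
  qed
  then show "terms sg X \<subseteq> generated sg (term_algebra sg X) (Var ` X)"
    by blast
qed

primrec term_val :: "('f, 'a) algebra \<Rightarrow> ('v \<Rightarrow> 'a) \<Rightarrow> ('f, 'v) trm \<Rightarrow> 'a" where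
  "term_val A v (Var x) = v x"
| "term_val A v (App f ts) = fop A f (map (term_val A v) ts)"

lemma is_hom_term_val:
  assumes A: "closed_under sg A (universe A)" and v: "\<And>x. x \<in> X \<Longrightarrow> v x \<in> universe A"
  shows "is_hom sg (term_algebra sg X) A (term_val A v)"
proof (rule is_homI)
  fix t assume "t \<in> universe (term_algebra sg X)"
  then have "t \<in> terms sg X"
    by (simp add: universe_term_algebra)
  then show "term_val A v t \<in> universe A"
  proof induction
    case (App f ts)
    then have "fop A f (map (term_val A v) ts) \<in> universe A"
      by (intro closed_underD[OF A]) auto
    then show ?case by simp
  qed (simp add: v)
qed (simp add: term_algebra_def)

context finite_type_quasivariety
begin

text \<open>The universal property of a finite presentation, read off at the level of terms. The two
  least congruences in its definition exist because relative congruences are closed under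
  intersections.\<close>

lemma finitely_presented_universal:
  assumes fp: "finitely_presented sg Q A"
  obtains X :: "nat set" and \<Sigma> \<phi> where "finite \<Sigma>" and "is_algebra sg (term_algebra sg X)"
    and "is_hom sg (term_algebra sg X) A \<phi>" and "\<phi> ` terms sg X = universe A"
    and "\<Sigma> \<subseteq> hom_kernel (term_algebra sg X) \<phi>"
    and "\<forall>B\<in>Q. \<forall>g. is_hom sg (term_algebra sg X) B g \<and> \<Sigma> \<subseteq> hom_kernel (term_algebra sg X) g \<longrightarrow>
           hom_kernel (term_algebra sg X) \<phi> \<subseteq> hom_kernel (term_algebra sg X) g"
proof -
  obtain X :: "nat set" and \<Sigma> where X: "finite X" and \<Sigma>: "finite \<Sigma>" "\<Sigma> \<subseteq> terms sg X \<times> terms sg X"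
    and iso: "isomorphic sg A (quotient_algebra (free_algebra sg Q X) (pres_cong sg Q X \<Sigma>))"
    and AQ: "A \<in> Q"
    using fp by (auto simp: finitely_presented_def)
  let ?T = "term_algebra sg X" and ?F = "free_algebra sg Q X"
  let ?\<rho> = "free_cong sg Q X" and ?\<theta> = "pres_cong sg Q X \<Sigma>"
  let ?P = "quotient_algebra ?F ?\<theta>"
  have A: "is_algebra sg A"
    using AQ by (rule member_is_algebra)
  obtain h where h: "is_hom sg A ?P h" "bij_betw h (universe A) (universe ?P)"
    using iso by (auto simp: isomorphic_def)
  have "universe ?P \<noteq> {}"
    using A h(2) by (auto simp: is_algebra_def bij_betw_def)
  then have "terms sg X \<noteq> {}"
    by (auto simp: quotient_algebra_def free_algebra_def universe_term_algebra quotient_def)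
  then have T: "is_algebra sg ?T"
    by (simp add: is_algebra_def universe_term_algebra closed_under_term_algebra)
  have "countable (universe ?T)"
    unfolding universe_term_algebra term_algebra_generated[symmetric]
    using X finite_type
    by (intro countable_generated)
      (auto simp: universe_term_algebra closed_under_term_algebra intro: terms.Var countable_finite)
  then obtain \<iota> :: "('f, nat) trm \<Rightarrow> 'u" where \<iota>: "inj_on \<iota> (universe ?T)"
    using countable_inj_infinite[OF infinite_carrier] by blast
  have "?\<rho> \<in> ConQ sg Q ?T"
    unfolding free_cong_def using ConQ_total[OF T \<iota>] by (intro ConQ_Inter[OF T \<iota>]) auto
  then have \<rho>: "congruence sg ?T ?\<rho>"
    by (simp add: ConQ_def)
  have F: "is_algebra sg ?F"
    unfolding free_algebra_def using \<rho> T by (rule is_algebra_quotient)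
  have p: "is_hom sg ?T ?F (\<lambda>t. ?\<rho> `` {t})"
    unfolding free_algebra_def using \<rho>
    by (rule congruence_class_hom) (simp add: universe_term_algebra closed_under_term_algebra)
  have p_surj: "(\<lambda>t. ?\<rho> `` {t}) ` universe ?T = universe ?F"
    unfolding free_algebra_def by (rule quotient_surj)
  have "countable (universe ?F)"
    unfolding p_surj[symmetric] using \<open>countable (universe ?T)\<close> by (rule countable_image)
  then obtain \<kappa> :: "('f, nat) trm set \<Rightarrow> 'u" where \<kappa>: "inj_on \<kappa> (universe ?F)"
    using countable_inj_infinite[OF infinite_carrier] by blast
  define C where "C = {\<theta>. \<theta> \<in> ConQ sg Q ?F \<and> (\<forall>(p, q)\<in>\<Sigma>. (?\<rho> `` {p}, ?\<rho> `` {q}) \<in> \<theta>)}"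
  have "universe ?F \<times> universe ?F \<in> C"
    using ConQ_total[OF F \<kappa>] \<Sigma>(2) is_hom_mem[OF p]
    by (auto simp: C_def universe_term_algebra)
  then have "\<Inter>C \<in> ConQ sg Q ?F"
    by (intro ConQ_Inter[OF F \<kappa>]) (auto simp: C_def)
  then have "\<Inter>C \<in> C"
    by (auto simp: C_def)
  moreover have "?\<theta> = \<Inter>C"
    unfolding pres_cong_def
  proof (rule Least_equality)
    show "\<Inter>C \<in> ConQ sg Q ?F \<and> (\<forall>(p, q)\<in>\<Sigma>. (?\<rho> `` {p}, ?\<rho> `` {q}) \<in> \<Inter>C)"
      using \<open>\<Inter>C \<in> C\<close> by (simp add: C_def)
  qed (auto simp: C_def)
  ultimately have \<theta>: "?\<theta> \<in> ConQ sg Q ?F" "\<And>p q. (p, q) \<in> \<Sigma> \<Longrightarrow> (?\<rho> `` {p}, ?\<rho> `` {q}) \<in> ?\<theta>"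
    and \<theta>_least: "\<And>\<psi>. \<psi> \<in> C \<Longrightarrow> ?\<theta> \<subseteq> \<psi>"
    by (auto simp: C_def)
  have \<theta>_cong: "congruence sg ?F ?\<theta>"
    using \<theta>(1) by (simp add: ConQ_def)
  have \<theta>_equiv: "equiv (universe ?F) ?\<theta>"
    using \<theta>_cong by (simp add: congruence_def)
  have r: "is_hom sg ?F ?P (\<lambda>x. ?\<theta> `` {x})"
    using \<theta>_cong F by (intro congruence_class_hom) (auto simp: is_algebra_def)
  let ?h' = "the_inv_into (universe A) h"
  have h': "is_hom sg ?P A ?h'" "bij_betw ?h' (universe ?P) (universe A)"
    using hom_inverse[OF h A] .
  define \<phi> where "\<phi> t = ?h' (?\<theta> `` {?\<rho> `` {t}})" for t
  have \<phi>: "is_hom sg ?T A \<phi>"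
    unfolding \<phi>_def using is_hom_comp[OF is_hom_comp[OF p r] h'(1)] .
  have cls: "?\<rho> `` {t} \<in> universe ?F" if "t \<in> terms sg X" for t
    using that is_hom_mem[OF p] by (simp add: universe_term_algebra)
  have \<phi>_eq: "\<phi> s = \<phi> t \<longleftrightarrow> (?\<rho> `` {s}, ?\<rho> `` {t}) \<in> ?\<theta>" if "s \<in> terms sg X" "t \<in> terms sg X" for s t
    unfolding \<phi>_def
    using inj_on_eq_iff[OF bij_betw_imp_inj_on[OF h'(2)]] is_hom_mem[OF r] cls that
      eq_equiv_class_iff[OF \<theta>_equiv] by auto
  have "\<phi> ` terms sg X = ?h' ` (\<lambda>x. ?\<theta> `` {x}) ` (\<lambda>t. ?\<rho> `` {t}) ` universe ?T"
    by (simp add: \<phi>_def image_image universe_term_algebra)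
  also have "\<dots> = universe A"
    unfolding p_surj quotient_surj[of ?\<theta> ?F] using h'(2) by (simp add: bij_betw_def)
  finally have \<phi>_surj: "\<phi> ` terms sg X = universe A" .
  show thesis
  proof (rule that[OF \<Sigma>(1) T \<phi> \<phi>_surj])
    show "\<Sigma> \<subseteq> hom_kernel ?T \<phi>"
      using \<phi>_eq \<theta>(2) \<Sigma>(2) by (auto simp: hom_kernel_def universe_term_algebra)
  next
    show "\<forall>B\<in>Q. \<forall>g. is_hom sg ?T B g \<and> \<Sigma> \<subseteq> hom_kernel ?T g \<longrightarrow> hom_kernel ?T \<phi> \<subseteq> hom_kernel ?T g"
    proof (intro ballI allI impI subrelI)
      fix B and g :: "('f, nat) trm \<Rightarrow> 'u" and s t
      assume B: "B \<in> Q" and "is_hom sg ?T B g \<and> \<Sigma> \<subseteq> hom_kernel ?T g"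
        and "(s, t) \<in> hom_kernel ?T \<phi>"
      then have g: "is_hom sg ?T B g" and g\<Sigma>: "\<And>p q. (p, q) \<in> \<Sigma> \<Longrightarrow> g p = g q"
        and st: "s \<in> terms sg X" "t \<in> terms sg X" "\<phi> s = \<phi> t"
        by (auto simp: hom_kernel_def universe_term_algebra)
      have "hom_kernel ?T g \<in> ConQ sg Q ?T"
        using ConQ_iff_kernel[OF T] B g by blast
      then have \<rho>g: "?\<rho> \<subseteq> hom_kernel ?T g"
        unfolding free_cong_def by blast
      have ker: "g x = g y" if "x \<in> universe ?T" "y \<in> universe ?T" "?\<rho> `` {x} = ?\<rho> `` {y}" for x y
      proof -
        have "(x, y) \<in> ?\<rho>"
          using that \<rho> eq_equiv_class_iff[of "universe ?T" ?\<rho> x y] by (simp add: congruence_def)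
        then show ?thesis
          using \<rho>g by (auto simp: hom_kernel_def)
      qed
      obtain k where k: "is_hom sg ?F B k" and kp: "\<And>x. x \<in> universe ?T \<Longrightarrow> k (?\<rho> `` {x}) = g x"
        using hom_factor[OF p p_surj g T] ker by blast
      have "hom_kernel ?F k \<in> ConQ sg Q ?F"
        using ConQ_iff_kernel[OF F] B k by blast
      moreover have "(?\<rho> `` {p}, ?\<rho> `` {q}) \<in> hom_kernel ?F k" if "(p, q) \<in> \<Sigma>" for p q
      proof -
        have "p \<in> terms sg X" "q \<in> terms sg X"
          using that \<Sigma>(2) by auto
        then show ?thesis
          using cls kp g\<Sigma>[OF that] by (simp add: hom_kernel_def universe_term_algebra)
      qed
      ultimately have "?\<theta> \<subseteq> hom_kernel ?F k"
        by (intro \<theta>_least) (auto simp: C_def)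
      then have "k (?\<rho> `` {s}) = k (?\<rho> `` {t})"
        using \<phi>_eq st by (auto simp: hom_kernel_def)
      then show "(s, t) \<in> hom_kernel ?T g"
        using kp st by (simp add: hom_kernel_def universe_term_algebra)
    qed
  qed
qed

text \<open>The defining relations of a finitely presented algebra and the inequality of two of its
  elements are finitely many conditions, so if they hold in an ultraproduct then they hold in
  one of the factors.\<close>

lemma finitely_presented_separated_in_factor:
  fixes I :: "'i set" and M :: "'i \<Rightarrow> ('f, 'u) algebra"
  assumes fp: "finitely_presented sg Q A" and U: "ultrafilter_on I U"
    and M: "\<And>i. i \<in> I \<Longrightarrow> M i \<in> Q"
    and h: "is_hom sg A (ultraproduct I U M) h"
    and ab: "a \<in> universe A" "b \<in> universe A" "h a \<noteq> h b"
  obtains i g where "i \<in> I" and "is_hom sg A (M i) g" and "g a \<noteq> g b"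
proof -
  obtain X :: "nat set" and \<Sigma> \<phi> where \<Sigma>: "finite \<Sigma>"
    and T: "is_algebra sg (term_algebra sg X)"
    and \<phi>: "is_hom sg (term_algebra sg X) A \<phi>" and \<phi>_surj: "\<phi> ` terms sg X = universe A"
    and \<phi>\<Sigma>: "\<Sigma> \<subseteq> hom_kernel (term_algebra sg X) \<phi>"
    and univ: "\<forall>B\<in>Q. \<forall>g. is_hom sg (term_algebra sg X) B g \<and> \<Sigma> \<subseteq> hom_kernel (term_algebra sg X) g \<longrightarrow>
           hom_kernel (term_algebra sg X) \<phi> \<subseteq> hom_kernel (term_algebra sg X) g"
    using finitely_presented_universal[OF fp] .
  let ?T = "term_algebra sg X" and ?P = "product_algebra I M"
  have M_closed: "closed_under sg (M i) (universe (M i))" if "i \<in> I" for i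
    using that M member_closed by blast
  obtain \<pi> where \<pi>: "is_hom sg ?P (ultraproduct I U M) \<pi>"
    and \<pi>_surj: "\<pi> ` universe ?P = universe (ultraproduct I U M)"
    and \<pi>_eq: "\<And>x y. x \<in> universe ?P \<Longrightarrow> y \<in> universe ?P \<Longrightarrow> \<pi> x = \<pi> y \<longleftrightarrow> {i\<in>I. x i = y i} \<in> U"
    using ultraproduct_class_hom[where M = M and sg = sg, OF U M_closed] by blast
  have h\<phi>: "is_hom sg ?T (ultraproduct I U M) (\<lambda>t. h (\<phi> t))"
    using \<phi> h by (rule is_hom_comp)
  \<comment> \<open>Lifting the images of the generators to the product lifts the whole homomorphism on terms,
    and the coordinates of the lift are the candidates for \<open>g\<close>.\<close>
  have "\<exists>y. y \<in> universe ?P \<and> \<pi> y = h (\<phi> (Var x))" if "x \<in> X" for x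
  proof -
    have "h (\<phi> (Var x)) \<in> \<pi> ` universe ?P"
      unfolding \<pi>_surj using that
      by (intro is_hom_mem[OF h\<phi>]) (auto simp: universe_term_algebra intro: terms.Var)
    then show ?thesis by force
  qed
  then obtain v where v: "\<And>x. x \<in> X \<Longrightarrow> v x \<in> universe ?P"
    and \<pi>v: "\<And>x. x \<in> X \<Longrightarrow> \<pi> (v x) = h (\<phi> (Var x))"
    by metis
  let ?e = "term_val ?P v"
  have e: "is_hom sg ?T ?P ?e"
    using closed_under_product[OF M_closed] v by (intro is_hom_term_val) auto
  have lift: "\<pi> (?e t) = h (\<phi> t)" if "t \<in> terms sg X" for t
  proof (rule hom_eq_on_generated[OF is_hom_comp[OF e \<pi>] h\<phi>])
    show "closed_under sg ?T (universe ?T)"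
      by (simp add: universe_term_algebra closed_under_term_algebra)
    show "Var ` X \<subseteq> universe ?T"
      by (auto simp: universe_term_algebra intro: terms.Var)
    show "t \<in> generated sg ?T (Var ` X)"
      using that by (simp add: term_algebra_generated)
  qed (use \<pi>v in auto)
  have coord: "{i\<in>I. ?e s i = ?e t i} \<in> U \<longleftrightarrow> h (\<phi> s) = h (\<phi> t)"
    if "s \<in> terms sg X" "t \<in> terms sg X" for s t
    using \<pi>_eq[of "?e s" "?e t"] is_hom_mem[OF e] lift that by (simp add: universe_term_algebra)
  obtain s t where st: "s \<in> terms sg X" "t \<in> terms sg X" "\<phi> s = a" "\<phi> t = b"
    using ab(1,2) unfolding \<phi>_surj[symmetric] by blast
  have "{i\<in>I. \<forall>(p, q)\<in>R. ?e p i = ?e q i} \<in> U" if "finite R" "R \<subseteq> \<Sigma>" for R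
    using that
  proof (induction R rule: finite_induct)
    case empty
    then show ?case
      using U by (simp add: ultrafilter_on_def)
  next
    case (insert z R)
    obtain p q where z: "z = (p, q)" by force
    have "{i\<in>I. ?e p i = ?e q i} \<in> U"
      using coord[of p q] \<phi>\<Sigma> insert.prems by (auto simp: z hom_kernel_def universe_term_algebra)
    moreover have "{i\<in>I. \<forall>(p, q)\<in>R. ?e p i = ?e q i} \<in> U"
      using insert by blast
    ultimately have "{i\<in>I. ?e p i = ?e q i} \<inter> {i\<in>I. \<forall>(p, q)\<in>R. ?e p i = ?e q i} \<in> U"
      using U unfolding ultrafilter_on_def by blast
    then show ?case
      by (rule ultrafilter_on_superset[OF U]) (auto simp: z)
  qed
  then have "{i\<in>I. \<forall>(p, q)\<in>\<Sigma>. ?e p i = ?e q i} \<in> U"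
    using \<Sigma> by blast
  moreover have "{i\<in>I. ?e s i = ?e t i} \<notin> U"
    using coord[OF st(1,2)] ab(3) st by simp
  ultimately have "\<not> {i\<in>I. \<forall>(p, q)\<in>\<Sigma>. ?e p i = ?e q i} \<subseteq> {i\<in>I. ?e s i = ?e t i}"
    using ultrafilter_on_superset[OF U] by (metis (no_types, lifting) mem_Collect_eq subsetI)
  then obtain i where i: "i \<in> I" "\<And>p q. (p, q) \<in> \<Sigma> \<Longrightarrow> ?e p i = ?e q i" "?e s i \<noteq> ?e t i"
    by blast
  let ?g = "\<lambda>t. ?e t i"
  have g: "is_hom sg ?T (M i) ?g"
    using e is_hom_projection[OF i(1)] by (rule is_hom_comp)
  have "\<Sigma> \<subseteq> hom_kernel ?T ?g"
    using \<phi>\<Sigma> i(2) by (auto simp: hom_kernel_def)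
  then have "hom_kernel ?T \<phi> \<subseteq> hom_kernel ?T ?g"
    using univ M[OF i(1)] g by blast
  then have ker: "?g x = ?g y" if "x \<in> universe ?T" "y \<in> universe ?T" "\<phi> x = \<phi> y" for x y
    using that by (auto simp: hom_kernel_def)
  have \<phi>_surj': "\<phi> ` universe ?T = universe A"
    using \<phi>_surj by (simp add: universe_term_algebra)
  obtain k where k: "is_hom sg A (M i) k" and k\<phi>: "\<And>x. x \<in> universe ?T \<Longrightarrow> k (\<phi> x) = ?g x"
    using hom_factor[OF \<phi> \<phi>_surj' g T] ker by blast
  have "k a \<noteq> k b"
    using k\<phi>[of s] k\<phi>[of t] i(3) st by (simp add: universe_term_algebra)
  with i(1) k show thesis
    by (rule that)
qed

end


section \<open>Class operators\<close>

lemma ISPPu_mono: "K \<subseteq> L \<Longrightarrow> ISPPu sg K \<subseteq> ISPPu sg L"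
proof -
  assume KL: "K \<subseteq> L"
  have Pu: "op_Pu K \<subseteq> op_Pu L"
    using KL unfolding op_Pu_def by blast
  have P: "op_P (op_Pu K) \<subseteq> op_P (op_Pu L)"
    using Pu unfolding op_P_def by blast
  have "op_S sg (op_P (op_Pu K)) \<subseteq> op_S sg (op_P (op_Pu L))"
    using P unfolding op_S_def by blast
  then show ?thesis
    unfolding ISPPu_def by (rule op_I_mono)
qed

lemma subset_ISPPu:
  fixes K :: "('f, 'u) algebra set"
  assumes K: "\<And>B. B \<in> K \<Longrightarrow> is_algebra sg B"
  shows "K \<subseteq> ISPPu sg K"
proof
  fix B assume B: "B \<in> K"
  \<comment> \<open>\<open>B\<close> embeds in the one-factor product of its one-factor ultraproduct.\<close>
  let ?I = "{undefined :: 'u}" and ?U = "{{undefined :: 'u}}"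
  have U: "ultrafilter_on ?I ?U"
    by (auto simp: ultrafilter_on_def)
  have closed: "closed_under sg B (universe B)"
    using K[OF B] by (simp add: is_algebra_def)
  obtain h where h: "is_hom sg B (ultraproduct ?I ?U (\<lambda>_. B)) h"
    and h_eq: "\<And>x y. x \<in> universe B \<Longrightarrow> y \<in> universe B \<Longrightarrow> h x = h y \<longleftrightarrow> {i\<in>?I. x = y} \<in> ?U"
    using locally_hom_into_ultraproduct[of ?I ?U sg "\<lambda>_. B" B "\<lambda>_ x. x", OF U closed closed]
    by auto
  let ?N = "\<lambda>_ :: 'u. ultraproduct ?I ?U (\<lambda>_. B)"
  have "inj_on h (universe B)"
    using h_eq by (auto intro!: inj_onI split: if_splits)
  then have "inj_on (\<lambda>x. \<lambda>j\<in>?I. h x) (universe B)"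
    by (auto simp: inj_on_def dest: fun_cong[where x = undefined])
  moreover have "is_hom sg B (product_algebra ?I ?N) (\<lambda>x. \<lambda>j\<in>?I. h x)"
    using h by (rule is_hom_into_product)
  moreover have "ultraproduct ?I ?U (\<lambda>_. B) \<in> op_Pu K"
    unfolding op_Pu_def using U B
    by (intro CollectI exI[of _ ?I] exI[of _ ?U] exI[of _ "\<lambda>_. B"]) simp
  then have "product_algebra ?I ?N \<in> op_P (op_Pu K)"
    unfolding op_P_def by (intro CollectI exI[of _ ?I] exI[of _ ?N]) simp
  ultimately show "B \<in> ISPPu sg K"
    unfolding ISPPu_def op_IS_iff_embedding[OF K[OF B]] by blast
qed

lemma op_V_hom_image:
  fixes K :: "('f, 'u) algebra set"
  assumes B: "B \<in> K" "is_algebra sg B" and A: "is_algebra sg A"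
    and h: "is_hom sg B A h" "h ` universe B = universe A"
  shows "A \<in> op_V sg K"
proof -
  \<comment> \<open>A one-factor product brings \<open>B\<close> into the form required by \<open>op_P\<close>.\<close>
  let ?P = "product_algebra {undefined :: 'u} (\<lambda>_. B)"
  have P: "?P \<in> op_P K"
    unfolding op_P_def using B(1) by (intro CollectI exI[of _ "{undefined}"] exI[of _ "\<lambda>_. B"]) simp
  have const: "(\<lambda>i\<in>{undefined}. x) \<in> universe ?P" if "x \<in> universe B" for x
    using that by (auto simp: product_algebra_def)
  have "closed_under sg ?P (universe ?P)"
    using B(2) by (intro closed_under_product) (simp add: is_algebra_def)
  then have "subalgebra sg ?P ?P"
    using const B(2) by (auto simp: subalgebra_def is_algebra_def)
  then have PS: "?P \<in> op_S sg (op_P K)"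
    unfolding op_S_def using P by blast
  have p: "is_hom sg ?P A (\<lambda>x. h (x undefined))"
    using is_hom_comp[OF is_hom_projection[of undefined "{undefined}" sg "\<lambda>_. B"] h(1)] by simp
  have "universe A \<subseteq> (\<lambda>x. h (x undefined)) ` universe ?P"
  proof
    fix y assume "y \<in> universe A"
    then obtain x where "x \<in> universe B" "y = h x"
      using h(2) by blast
    then show "y \<in> (\<lambda>x. h (x undefined)) ` universe ?P"
      using const by (intro image_eqI[of _ _ "\<lambda>i\<in>{undefined}. x"]) auto
  qed
  then have "(\<lambda>x. h (x undefined)) ` universe ?P = universe A"
    using p by (auto simp: is_hom_def)
  then show ?thesis
    unfolding op_V_def op_H_def using A PS p by blast
qed

lemma product_separated:
  assumes "x \<in> universe (product_algebra J M)" and "y \<in> universe (product_algebra J M)" and "x \<noteq> y"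
  obtains j where "j \<in> J" and "x j \<noteq> y j"
  using assms PiE_ext[of x J "\<lambda>j. universe (M j)" y] by (auto simp: product_algebra_def)


section \<open>Subdirect decomposition\<close>

context finite_type_quasivariety
begin

lemma op_I_mem:
  fixes A :: "('f, 'u) algebra"
  assumes "A \<in> op_I sg Q"
  shows "A \<in> Q"
proof -
  obtain B where B: "B \<in> Q" "isomorphic sg B A" and A: "is_algebra sg A"
    using assms by (auto simp: op_I_def)
  have "B \<in> ISPPu sg Q"
    using B(1) quasivariety by (simp add: quasivariety_def)
  then have "A \<in> ISPPu sg Q"
    unfolding ISPPu_def op_I_def using A B(2) isomorphic_trans by blast
  then show ?thesis
    using quasivariety by (simp add: quasivariety_def)
qed

lemma embedding_product_mem:
  fixes A :: "('f, 'a) algebra" and \<iota> :: "'a \<Rightarrow> 'u"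
  assumes A: "is_algebra sg A" and \<iota>: "inj_on \<iota> (universe A)"
    and e: "is_hom sg A (product_algebra J M) e" "inj_on e (universe A)"
    and M: "\<And>j. j \<in> J \<Longrightarrow> M j \<in> Q"
  shows "A \<in> op_I sg Q"
proof (rule locally_separated_mem[OF A \<iota>])
  fix S a b assume S: "S \<subseteq> universe A" and ab: "a \<in> universe A" "b \<in> universe A" "a \<noteq> b"
  then have "e a \<noteq> e b"
    using e(2) by (auto dest: inj_onD)
  then obtain j where j: "j \<in> J" "e a j \<noteq> e b j"
    using product_separated is_hom_mem[OF e(1)] ab by metis
  have g: "is_hom sg A (M j) (\<lambda>x. e x j)"
    using e(1) is_hom_projection[OF j(1)] by (rule is_hom_comp)
  have "(\<lambda>x. e x j) (fop A f xs) = fop (M j) f (map (\<lambda>x. e x j) xs)"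
    if "sg f = Some (length xs)" "set xs \<subseteq> S" for f xs
    using is_hom_op[OF g] that S by auto
  then show "\<exists>B\<in>Q. \<exists>g. g ` universe A \<subseteq> universe B \<and> g a \<noteq> g b \<and>
      (\<forall>f xs. sg f = Some (length xs) \<and> set xs \<subseteq> S \<longrightarrow> g (fop A f xs) = fop B f (map g xs))"
    using M[OF j(1)] j(2) is_hom_mem[OF g]
    by (intro bexI[of _ "M j"] exI[of _ "\<lambda>x. e x j"]) auto
qed

text \<open>Birkhoff's subdirect decomposition: by Zorn's lemma there is a maximal relative congruence
  not identifying \<open>a\<close> and \<open>b\<close>, and in its quotient every further identification
  identifies the images of \<open>a\<close> and \<open>b\<close>. The quotient is taken as the image of a homomorphism
  with this kernel, so that it lives on \<open>'u\<close>.\<close>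

lemma separating_irreducible_image:
  assumes CQ: "C \<in> Q" and ab: "a \<in> universe C" "b \<in> universe C" "a \<noteq> b"
  obtains D \<phi> where "Q_irreducible sg Q D" and "is_hom sg C D \<phi>" and "\<phi> ` universe C = universe D"
    and "\<phi> a \<noteq> \<phi> b"
proof -
  have C: "is_algebra sg C"
    using CQ by (rule member_is_algebra)
  define F where "F = {\<theta> \<in> ConQ sg Q C. (a, b) \<notin> \<theta>}"
  have "\<exists>M\<in>F. \<forall>X\<in>F. M \<subseteq> X \<longrightarrow> X = M"
  proof (rule subset_Zorn_nonempty)
    have "hom_kernel C (\<lambda>x. x) \<in> ConQ sg Q C"
      using ConQ_iff_kernel[OF C] CQ is_hom_id by blast
    then have "hom_kernel C (\<lambda>x. x) \<in> F"
      using ab by (simp add: F_def hom_kernel_def)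
    then show "F \<noteq> {}"
      by blast
    fix W assume W: "W \<noteq> {}" "subset.chain F W"
    have "inj_on (\<lambda>x. x) (universe C)"
      by simp
    moreover have "subset.chain (ConQ sg Q C) W"
      using W(2) by (auto simp: subset_chain_def F_def)
    ultimately have "\<Union>W \<in> ConQ sg Q C"
      using ConQ_Union_chain[OF C] W(1) by blast
    moreover have "(a, b) \<notin> \<Union>W"
      using W(2) by (auto simp: subset_chain_def F_def)
    ultimately show "\<Union>W \<in> F"
      by (simp add: F_def)
  qed
  then obtain \<theta> where \<theta>: "\<theta> \<in> ConQ sg Q C" "(a, b) \<notin> \<theta>"
    and max: "\<And>\<psi>. \<psi> \<in> ConQ sg Q C \<Longrightarrow> (a, b) \<notin> \<psi> \<Longrightarrow> \<theta> \<subseteq> \<psi> \<Longrightarrow> \<psi> = \<theta>"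
    unfolding F_def by blast
  obtain B \<phi> where B: "B \<in> Q" and \<phi>: "is_hom sg C B \<phi>" and ker: "\<theta> = hom_kernel C \<phi>"
    using \<theta>(1) ConQ_iff_kernel[OF C] by blast
  let ?D = "B\<lparr>universe := \<phi> ` universe C\<rparr>"
  have D: "is_algebra sg ?D"
    using \<phi> C by (rule is_algebra_hom_image)
  have "is_hom sg ?D B (\<lambda>x. x)"
    using is_hom_mem[OF \<phi>] by (auto simp: is_hom_def)
  then have DQ: "?D \<in> Q"
    using embedding_mem[OF D] B by (intro op_I_mem) auto
  have \<phi>D: "is_hom sg C ?D \<phi>"
    using \<phi> by (auto simp: is_hom_def)
  have sep: "\<phi> a \<noteq> \<phi> b"
    using \<theta>(2) ab by (simp add: ker hom_kernel_def)
  have "(\<phi> a, \<phi> b) \<in> \<psi>" if \<psi>: "\<psi> \<in> ConQ sg Q ?D" "\<psi> \<noteq> Id_on (universe ?D)" for \<psi>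
  proof (rule ccontr)
    assume neg: "(\<phi> a, \<phi> b) \<notin> \<psi>"
    obtain E k where E: "E \<in> Q" and k: "is_hom sg ?D E k" and \<psi>k: "\<psi> = hom_kernel ?D k"
      using \<psi>(1) ConQ_iff_kernel[OF D] by blast
    have "hom_kernel C (\<lambda>x. k (\<phi> x)) \<in> ConQ sg Q C"
      using ConQ_iff_kernel[OF C] E is_hom_comp[OF \<phi>D k] by blast
    moreover have "(a, b) \<notin> hom_kernel C (\<lambda>x. k (\<phi> x))"
      using neg ab by (simp add: \<psi>k hom_kernel_def)
    moreover have "\<theta> \<subseteq> hom_kernel C (\<lambda>x. k (\<phi> x))"
      by (auto simp: ker hom_kernel_def)
    ultimately have eq: "hom_kernel C (\<lambda>x. k (\<phi> x)) = hom_kernel C \<phi>"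
      using max ker by blast
    have "x = y" if xy: "(x, y) \<in> \<psi>" for x y
    proof -
      obtain u v where uv: "u \<in> universe C" "v \<in> universe C" "x = \<phi> u" "y = \<phi> v" and "k x = k y"
        using xy by (auto simp: \<psi>k hom_kernel_def)
      then have "(u, v) \<in> hom_kernel C (\<lambda>x. k (\<phi> x))"
        by (simp add: hom_kernel_def)
      then show ?thesis
        unfolding eq using uv by (simp add: hom_kernel_def)
    qed
    moreover have "\<psi> \<subseteq> universe ?D \<times> universe ?D" "Id_on (universe ?D) \<subseteq> \<psi>"
      unfolding \<psi>k hom_kernel_def by auto
    ultimately have "\<psi> = Id_on (universe ?D)"
      by (fastforce simp: Id_on_iff)
    then show False
      using \<psi>(2) by contradiction
  qed
  then have "Q_irreducible sg Q ?D"
    unfolding Q_irreducible_def using DQ sep ab by auto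
  then show thesis
    using \<phi>D sep by (intro that[of ?D \<phi>]) auto
qed


section \<open>Classes omitting an irreducible algebra\<close>

text \<open>If the irreducible algebra \<open>A\<close> embeds in a product of ultraproducts, then one of the
  projections separates its critical pair \<open>a \<noteq> b\<close>. Finite presentability moves this
  separation to a single factor of that ultraproduct, where the kernel, missing \<open>(a, b)\<close>,
  must be trivial: \<open>A\<close> embeds in that factor.\<close>

lemma quasivariety_omitting:
  assumes fp: "finitely_presented sg Q A" and irr: "Q_irreducible sg Q A"
  shows "quasivariety sg (omitting sg Q A)"
proof -
  let ?K = "omitting sg Q A"
  have AQ: "A \<in> Q"
    using irr by (simp add: Q_irreducible_def)
  then have A: "is_algebra sg A"
    by (rule member_is_algebra)
  obtain a b where ab: "a \<in> universe A" "b \<in> universe A" "a \<noteq> b"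
    and crit: "\<And>\<theta>. \<theta> \<in> ConQ sg Q A \<Longrightarrow> \<theta> \<noteq> Id_on (universe A) \<Longrightarrow> (a, b) \<in> \<theta>"
    using irr by (auto simp: Q_irreducible_def)
  have KQ: "?K \<subseteq> Q"
    by (auto simp: omitting_def)
  have "?K \<subseteq> ISPPu sg ?K"
    using KQ member_is_algebra by (intro subset_ISPPu) blast
  moreover have "ISPPu sg ?K \<subseteq> ?K"
  proof
    fix C assume C: "C \<in> ISPPu sg ?K"
    then have CQ: "C \<in> Q"
      using ISPPu_mono[OF KQ] quasivariety by (auto simp: quasivariety_def)
    have "A \<notin> op_I sg (op_S sg {C})"
    proof
      assume "A \<in> op_I sg (op_S sg {C})"
      then obtain e where e: "is_hom sg A C e" "inj_on e (universe A)"
        unfolding op_IS_iff_embedding[OF A] by blast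
      obtain P :: "('f, 'u \<Rightarrow> ('u \<Rightarrow> 'u) set) algebra" and d
        where P: "P \<in> op_P (op_Pu ?K :: ('f, ('u \<Rightarrow> 'u) set) algebra set)"
        and d: "is_hom sg C P d" "inj_on d (universe C)"
        using C unfolding ISPPu_def op_IS_iff_embedding[OF member_is_algebra[OF CQ]] by blast
      obtain J :: "'u set" and N where N: "\<And>j. j \<in> J \<Longrightarrow> N j \<in> op_Pu ?K" and PJ: "P = product_algebra J N"
        using P unfolding op_P_def by blast
      have ed: "is_hom sg A (product_algebra J N) (\<lambda>x. d (e x))"
        using is_hom_comp[OF e(1) d(1)] by (simp add: PJ)
      have "d (e a) \<noteq> d (e b)"
        using ab e d(2) by (auto dest!: inj_onD[OF d(2)] inj_onD[OF e(2)] simp: is_hom_mem)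
      then obtain j where j: "j \<in> J" "d (e a) j \<noteq> d (e b) j"
        using product_separated is_hom_mem[OF ed] ab by metis
      obtain I :: "'u set" and U M where U: "ultrafilter_on I U" and M: "\<And>i. i \<in> I \<Longrightarrow> M i \<in> ?K"
        and Nj: "N j = ultraproduct I U M"
        using N[OF j(1)] unfolding op_Pu_def by blast
      have "is_hom sg A (N j) (\<lambda>x. d (e x) j)"
        using ed is_hom_projection[OF j(1)] by (rule is_hom_comp)
      then have h: "is_hom sg A (ultraproduct I U M) (\<lambda>x. d (e x) j)"
        by (simp add: Nj)
      obtain i g where i: "i \<in> I" and g: "is_hom sg A (M i) g" "g a \<noteq> g b"
        using finitely_presented_separated_in_factor[OF fp U _ h ab(1,2) j(2)] M KQ by blast
      have "hom_kernel A g \<in> ConQ sg Q A"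
        using ConQ_iff_kernel[OF A] M[OF i] KQ g(1) by blast
      then have "hom_kernel A g = Id_on (universe A)"
        using crit g(2) by (auto simp: hom_kernel_def)
      then have "inj_on g (universe A)"
        unfolding hom_kernel_def Id_on_def by (intro inj_onI) blast
      then have "A \<in> op_I sg (op_S sg {M i})"
        unfolding op_IS_iff_embedding[OF A] using g(1) by blast
      then show False
        using M[OF i] by (simp add: omitting_def)
    qed
    then show "C \<in> ?K"
      using CQ by (simp add: omitting_def)
  qed
  ultimately show ?thesis
    by (auto simp: quasivariety_def)
qed


section \<open>Primitivity and weak projectivity\<close>

text \<open>Let \<open>A \<in> Q\<close> be an image of a subalgebra of a product of members of \<open>K\<close>.
  Membership of \<open>A\<close> in \<open>K\<close> only has to be tested on finitely generated subalgebras, and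
  each of these is separated by finitely generated \<open>Q\<close>-irreducible images \<open>D\<close>. Lifting
  finitely many generators shows that \<open>D\<close> is an image of a finitely generated member of
  \<open>K\<close>, which contains \<open>D\<close> as a subalgebra by weak projectivity.\<close>

lemma variety_members_of_subquasivariety:
  assumes wp: "\<And>D. D \<in> Q \<Longrightarrow> finitely_generated sg D \<Longrightarrow> Q_irreducible sg Q D \<Longrightarrow>
                weakly_projective sg (fg_members sg Q) D"
    and K: "quasivariety sg K" "K \<subseteq> Q" and A: "A \<in> op_V sg K" "A \<in> Q"
  shows "A \<in> K"
proof -
  interpret K: finite_type_quasivariety sg K
    using infinite_carrier finite_type K(1) by unfold_locales
  have algA: "is_algebra sg A" and closedA: "closed_under sg A (universe A)"
    using A(2) member_is_algebra member_closed by auto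
  obtain B h and P :: "('f, 'u \<Rightarrow> 'u) algebra" where P: "P \<in> op_P K" and sub: "subalgebra sg B P"
    and h: "is_hom sg B A h" "h ` universe B = universe A"
    using A(1) unfolding op_V_def op_H_def op_S_def by blast
  obtain J :: "'u set" and M where M: "\<And>j. j \<in> J \<Longrightarrow> M j \<in> K" and PJ: "P = product_algebra J M"
    using P unfolding op_P_def by blast
  have closedB: "closed_under sg B (universe B)"
    using sub by (simp add: subalgebra_def is_algebra_def)
  have "A \<in> op_I sg K"
  proof (rule K.locally_separated_mem[OF algA inj_on_id2])
    fix S a b assume S: "finite S" "S \<subseteq> universe A"
      and ab: "a \<in> universe A" "b \<in> universe A" "a \<noteq> b"
    let ?G = "S \<union> {a, b}"
    have "finite ?G" "?G \<subseteq> h ` universe B"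
      using S ab h(2) by auto
    then obtain G' where G': "G' \<subseteq> universe B" "finite G'" "?G = h ` G'"
      using finite_subset_image by metis
    define X where "X = generated sg B G'"
    define Y where "Y = generated sg A ?G"
    have X: "X \<subseteq> universe B" "closed_under sg B X"
      unfolding X_def using closedB G'(1) by (auto intro: closed_under_generated dest: generated_subset_universe)
    have Y: "Y \<subseteq> universe A" "closed_under sg A Y" "?G \<subseteq> Y"
      unfolding Y_def using closedA S ab
      by (simp_all only: closed_under_generated generated_superset) (rule generated_subset_universe, auto)
    have hX: "h ` X = Y"
      unfolding X_def Y_def G'(3) using h(1) closedB G'(1) by (rule hom_image_generated)
    have "X \<noteq> {}"
      using hX Y(3) by auto
    let ?C = "A\<lparr>universe := Y\<rparr>" and ?B = "B\<lparr>universe := X\<rparr>"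
    have C: "is_algebra sg ?C"
      using Y by (intro is_algebra_subuniverse) auto
    have "is_hom sg ?C A (\<lambda>x. x)"
      using Y(1) by (auto simp: is_hom_def)
    then have CQ: "?C \<in> Q"
      using embedding_mem[OF C] A(2) by (intro op_I_mem) auto
    obtain D \<phi> where D: "Q_irreducible sg Q D" and \<phi>: "is_hom sg ?C D \<phi>" "\<phi> ` universe ?C = universe D"
      and sep: "\<phi> a \<noteq> \<phi> b"
      using separating_irreducible_image[OF CQ, of a b] Y(3) ab(3) by auto
    have DQ: "D \<in> Q"
      using D by (simp add: Q_irreducible_def)
    then have algD: "is_algebra sg D"
      by (rule member_is_algebra)
    have algB: "is_algebra sg ?B"
      using X \<open>X \<noteq> {}\<close> by (intro is_algebra_subuniverse)
    have closedB': "closed_under sg ?B (universe ?B)"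
      using algB by (simp add: is_algebra_def)
    have fgB: "finitely_generated sg ?B"
      unfolding X_def using closedB G'(1,2) by (rule finitely_generated_subuniverse)
    have "countable (universe ?B)"
      using countable_generated[OF closedB G'(1) countable_finite[OF G'(2)] finite_type]
      by (simp add: X_def)
    then obtain \<iota> :: "('u \<Rightarrow> 'u) \<Rightarrow> 'u" where \<iota>: "inj_on \<iota> (universe ?B)"
      using countable_inj_infinite[OF infinite_carrier] by blast
    have "is_hom sg ?B P (\<lambda>x. x)"
      using sub X(1) by (auto simp: is_hom_def subalgebra_def)
    then have "?B \<in> op_I sg K"
      using K.embedding_product_mem[OF algB \<iota>, of J M "\<lambda>x. x"] M by (simp add: PJ)
    then obtain E where E: "E \<in> K" and iso: "isomorphic sg E ?B"
      by (auto simp: op_I_def)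
    have algE: "is_algebra sg E"
      using E by (rule K.member_is_algebra)
    obtain i where i: "is_hom sg E ?B i" "bij_betw i (universe E) (universe ?B)"
      using iso by (auto simp: isomorphic_def)
    obtain i' where i': "is_hom sg ?B E i'" "bij_betw i' (universe ?B) (universe E)"
      using hom_inverse[OF i algE] by blast
    have "finitely_generated sg E"
      using i'(2) by (intro finitely_generated_hom_image[OF i'(1) _ closedB' fgB]) (simp add: bij_betw_def)
    then have EQ: "E \<in> fg_members sg Q"
      using E K(2) by (auto simp: fg_members_def)
    have hB: "is_hom sg ?B ?C h"
      using h(1) X(1) hX by (intro is_hom_subuniverse) auto
    have onto: "is_hom sg E D (\<lambda>x. \<phi> (h (i x)))"
      using is_hom_comp[OF is_hom_comp[OF i(1) hB] \<phi>(1)] .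
    have "(\<lambda>x. \<phi> (h (i x))) ` universe E = \<phi> ` h ` i ` universe E"
      by (simp add: image_image)
    also have "\<dots> = universe D"
      using i(2) hX \<phi>(2) by (simp add: bij_betw_def)
    finally have onto': "(\<lambda>x. \<phi> (h (i x))) ` universe E = universe D" .
    have fgD: "finitely_generated sg D"
      using finitely_generated_hom_image[OF onto onto'] algE \<open>finitely_generated sg E\<close>
      by (simp add: is_algebra_def)
    have "D \<in> op_H sg {E}"
      unfolding op_H_def using algD onto onto' by blast
    then have "D \<in> op_I sg (op_S sg {E})"
      using wp[OF DQ fgD D] EQ by (simp add: weakly_projective_def)
    then obtain k where k: "is_hom sg D E k" "inj_on k (universe D)"
      unfolding op_IS_iff_embedding[OF algD] by blast
    have k\<phi>: "is_hom sg ?C E (\<lambda>x. k (\<phi> x))"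
      using \<phi>(1) k(1) by (rule is_hom_comp)
    \<comment> \<open>Outside \<open>Y\<close> the value is arbitrary: all arguments and results that matter lie in \<open>Y\<close>.\<close>
    define g where "g x = (if x \<in> Y then k (\<phi> x) else k (\<phi> a))" for x
    have mem: "k (\<phi> x) \<in> universe E" if "x \<in> Y" for x
      using is_hom_mem[OF k\<phi>] that by simp
    have "g ` universe A \<subseteq> universe E"
      using mem Y(3) by (auto simp: g_def)
    moreover have "g a \<noteq> g b"
      using sep Y(3) inj_onD[OF k(2)] is_hom_mem[OF \<phi>(1)] by (auto simp: g_def)
    moreover have "g (fop A f xs) = fop E f (map g xs)"
      if f: "sg f = Some (length xs)" and xs: "set xs \<subseteq> S" for f xs
    proof -
      have xsY: "set xs \<subseteq> Y"
        using xs Y(3) by auto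
      have "k (\<phi> (fop A f xs)) = fop E f (map (\<lambda>x. k (\<phi> x)) xs)"
        using is_hom_op[OF k\<phi> f] xsY by simp
      moreover have "map g xs = map (\<lambda>x. k (\<phi> x)) xs"
        using xsY by (auto simp: g_def)
      moreover have "fop A f xs \<in> Y"
        using Y(2) f xsY by (rule closed_underD)
      then have "g (fop A f xs) = k (\<phi> (fop A f xs))"
        by (simp add: g_def)
      ultimately show ?thesis
        by (simp only:)
    qed
    ultimately show "\<exists>B\<in>K. \<exists>g. g ` universe A \<subseteq> universe B \<and> g a \<noteq> g b \<and>
        (\<forall>f xs. sg f = Some (length xs) \<and> set xs \<subseteq> S \<longrightarrow> g (fop A f xs) = fop B f (map g xs))"
      using E by (intro bexI[of _ E] exI[of _ g]) auto
  qed
  then show ?thesis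
    by (rule K.op_I_mem)
qed

end

theorem theorem3p10:
  fixes sg :: "'f signature" and Q :: "('f, 'u) algebra set"
  assumes "infinite (UNIV :: 'u set)"
    and "finite (dom sg)"
    and "quasivariety sg Q"
    and "tame sg Q"
  shows "(primitive sg Q \<longleftrightarrow>
            (\<forall>A\<in>Q. finitely_generated sg A \<and> Q_irreducible sg Q A \<longrightarrow>
               equational_relative sg Q (omitting sg Q A))) \<and>
         (primitive sg Q \<longleftrightarrow>
            (\<forall>A\<in>Q. finitely_generated sg A \<and> Q_irreducible sg Q A \<longrightarrow>
               weakly_projective sg Q A)) \<and>
         (primitive sg Q \<longleftrightarrow>
            (\<forall>A\<in>Q. finitely_generated sg A \<and> Q_irreducible sg Q A \<longrightarrow>
               weakly_projective sg (fg_members sg Q) A))"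
    (is "(_ \<longleftrightarrow> ?omit) \<and> (_ \<longleftrightarrow> ?proj) \<and> (_ \<longleftrightarrow> ?fgproj)")
proof -
  interpret finite_type_quasivariety sg Q
    using assms(1-3) by unfold_locales
  have "?omit" if "primitive sg Q"
  proof (intro ballI impI)
    fix A assume "A \<in> Q" and A: "finitely_generated sg A \<and> Q_irreducible sg Q A"
    then have "finitely_presented sg Q A"
      using assms(4) by (simp add: tame_def)
    then have "quasivariety sg (omitting sg Q A)"
      using A by (intro quasivariety_omitting) auto
    moreover have "omitting sg Q A \<subseteq> Q"
      by (auto simp: omitting_def)
    ultimately show "equational_relative sg Q (omitting sg Q A)"
      using that by (simp add: primitive_def)
  qed
  moreover have "?proj" if omit: "?omit"
  proof (intro ballI impI)
    fix A assume AQ: "A \<in> Q" and fgi: "finitely_generated sg A \<and> Q_irreducible sg Q A"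
    have A: "is_algebra sg A"
      using AQ by (rule member_is_algebra)
    show "weakly_projective sg Q A"
      unfolding weakly_projective_def
    proof (intro ballI impI, rule ccontr)
      fix B assume B: "B \<in> Q" "A \<in> op_H sg {B}" and "A \<notin> op_I sg (op_S sg {B})"
      then have "B \<in> omitting sg Q A"
        by (simp add: omitting_def)
      then have "A \<in> op_V sg (omitting sg Q A)"
        using B A member_is_algebra op_V_hom_image[of B "omitting sg Q A" sg A] by (auto simp: op_H_def)
      then have "A \<in> omitting sg Q A"
        using omit AQ fgi by (auto simp: equational_relative_def)
      moreover have "A \<in> op_I sg (op_S sg {A})"
        unfolding op_IS_iff_embedding[OF A] using is_hom_id by (auto intro: inj_on_id2)
      ultimately show False
        by (simp add: omitting_def)
    qed
  qed
  moreover have "?fgproj" if "?proj"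
    using that by (auto simp: weakly_projective_def fg_members_def)
  moreover have "primitive sg Q" if fgproj: "?fgproj"
    unfolding primitive_def equational_relative_def
  proof (intro allI impI)
    fix K assume K: "quasivariety sg K \<and> K \<subseteq> Q"
    have "K \<subseteq> op_V sg K"
    proof
      fix B assume B: "B \<in> K"
      then have "is_algebra sg B"
        using K member_is_algebra by blast
      with B show "B \<in> op_V sg K"
        using op_V_hom_image[OF B _ _ is_hom_id] by simp
    qed
    moreover have "op_V sg K \<inter> Q \<subseteq> K"
      using variety_members_of_subquasivariety[of K] K fgproj by blast
    ultimately show "K = op_V sg K \<inter> Q"
      using K by blast
  qed
  ultimately show ?thesis
    by blast
qed

end
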